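(* Let $A$ be a $2\times2$ integer matrix such that $\det(A)\ne0$ and no eigenvalue of $A$ is a root of unity. Assume that $f\in L^2(\mathbb T^2,dx)$ has the trigonometric expansion \[ f(x)=\sum_{\xi\in\mathbb Z^2}\widehat f(\xi)e^{2\pi ix\xi} \] and that, for some $\delta>0$, \[ \sum_{\xi\in\mathbb Z^2}(\log(1+|\xi|))^{1+\delta}|\widehat f(\xi)|^2<+\infty . \] Then, for every $\eta>0$ and for almost every $x\in\mathbb T^2$, \[ \lim_{N\to+\infty}\frac{\sqrt N}{(\log(1+N))^{\frac32+\eta}}\bigg|\frac1N\sum_{n=0}^{N-1}f(A^nx)-\int_{\mathbb T^2}f(y)\,dy\bigg|=0 . \]
   Context: $\mathbb T^2=\mathbb R^2/\mathbb Z^2$ is the two-dimensional torus with normalized Lebesgue measure $dx$, on which an integer matrix $A$ acts by $x\mapsto Ax$ modulo $\mathbb Z^2$. $x\xi$ denotes the scalar product, $|\xi|$ the Euclidean norm, and $\widehat f(\xi)=\int_{\mathbb T^2}f(x)e^{-2\pi ix\xi}\,dx$. *)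

theory Defs
  imports "HOL-Analysis.Analysis"
begin

text \<open>The torus \<open>\<real>\<^sup>2/\<int>\<^sup>2\<close> is represented by its fundamental domain \<open>[0,1)\<^sup>2\<close>, a class modulo
  \<open>\<int>\<^sup>2\<close> being identified with its unique representative there. Functions on the torus are
  functions on \<^typ>\<open>real^2\<close> whose values outside \<open>[0,1)\<^sup>2\<close> are irrelevant.\<close>

definition torus :: "(real^2) measure" where
  "torus = lebesgue_on {x. \<forall>i. 0 \<le> x $ i \<and> x $ i < 1}"

definition torus_map :: "int^2^2 \<Rightarrow> real^2 \<Rightarrow> real^2" where
  "torus_map A x = (\<chi> i. frac ((map_matrix of_int A *v x) $ i))"

definition real_vec :: "int^2 \<Rightarrow> real^2" where
  "real_vec \<xi> = (\<chi> i. of_int (\<xi> $ i))"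

definition square_integrable :: "'a measure \<Rightarrow> ('a \<Rightarrow> complex) \<Rightarrow> bool" where
  "square_integrable M f \<longleftrightarrow>
     f \<in> borel_measurable M \<and> integrable M (\<lambda>x. (norm (f x))\<^sup>2)"

definition fourier_coeff :: "(real^2 \<Rightarrow> complex) \<Rightarrow> int^2 \<Rightarrow> complex" where
  "fourier_coeff f \<xi> =
     (LINT x|torus. f x * exp (- (2 * of_real pi * \<i> * of_real (x \<bullet> real_vec \<xi>))))"

definition complex_eigenvalue :: "int^2^2 \<Rightarrow> complex \<Rightarrow> bool" where
  "complex_eigenvalue A \<mu> \<longleftrightarrow>
     (\<exists>v :: complex^2. v \<noteq> 0 \<and> map_matrix of_int A *v v = \<mu> *s v)"

definition root_of_unity :: "complex \<Rightarrow> bool" where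
  "root_of_unity z \<longleftrightarrow> (\<exists>n::nat. n > 0 \<and> z ^ n = 1)"

lemma space_torus: "space torus = {x. \<forall>i. 0 \<le> x $ i \<and> x $ i < 1}"
  by (simp add: torus_def space_restrict_space)

lemma torus_map_in_torus: "torus_map A x \<in> space torus"
  by (simp add: space_torus torus_map_def frac_lt_1)

lemma unit_square_lebesgue:
  "{x :: real^2. \<forall>i. 0 \<le> x $ i \<and> x $ i < 1} \<in> sets lebesgue"
proof -
  have "{x :: real^2. \<forall>i. 0 \<le> x $ i \<and> x $ i < 1} \<in> sets borel"
    by measurable
  then show ?thesis by simp
qed

lemma emeasure_torus: "emeasure torus (space torus) = 1"
proof -
  let ?Q = "{x :: real^2. \<forall>i. 0 \<le> x $ i \<and> x $ i < 1}"
  have one: "(1 :: real^2) \<in> cbox 0 1 \<and> (\<forall>b\<in>Basis. (1 :: real^2) \<bullet> b = 1)"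
    by (auto simp: mem_box_cart Basis_vec_def inner_axis)
  have "emeasure lborel (box (0 :: real^2) 1) = 1" "emeasure lborel (cbox (0 :: real^2) 1) = 1"
    using one by (auto simp: emeasure_lborel_box_eq emeasure_lborel_cbox_eq)
  moreover have "box 0 1 \<subseteq> ?Q" "?Q \<subseteq> cbox 0 1"
    by (auto simp: mem_box_cart less_imp_le)
  moreover have Q: "?Q \<in> sets borel" by measurable
  ultimately have "emeasure lborel ?Q = 1"
    using emeasure_mono[of "box 0 1" ?Q lborel] emeasure_mono[of ?Q "cbox 0 1" lborel]
    by (simp add: antisym)
  then show ?thesis
    unfolding space_torus using Q unit_square_lebesgue
    by (simp add: torus_def emeasure_restrict_space)
qed

end

theory Submission
  imports Defs
begin

text \<open>Let \<open>B\<close> be the transpose of \<open>A\<close>. Composition with \<open>A\<close> maps the character of frequency \<open>\<xi>\<close> to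
  that of \<open>B \<xi>\<close>, so the Fourier coefficient of a Birkhoff sum at \<open>\<zeta>\<close> is a sum of coefficients of
  \<open>f\<close> along the backward \<open>B\<close>-orbit of \<open>\<zeta>\<close>. Because \<open>\<bar>\<xi>\<bar>\<^sup>2 \<bar>B\<^sup>k \<xi>\<bar>\<^sup>2\<close> grows exponentially in \<open>k\<close>,
  uniformly in \<open>\<xi> \<noteq> 0\<close>, the inverse weights \<open>(log (1 + \<bar>\<xi>\<bar>)) powr -(1 + \<delta>)\<close> have uniformly bounded
  sums along orbits, and Cauchy--Schwarz bounds the square of the \<open>L\<^sup>2\<close> norm of the \<open>N\<close>-th centred
  Birkhoff sum by a constant times \<open>N\<close>. The Rademacher--Menshov dyadic decomposition turns this
  bound into the almost everywhere rate.\<close>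

section \<open>Growth of orbits of integer vectors\<close>

text \<open>An orbit may first shrink, by an eigenvalue inside the unit disc, for a time with no
  bound uniform in \<open>\<xi>\<close>; hence growth is claimed for a product of two norms and not
  for one. Eigenvalues are never compared in size. The lower bound rests on integrality: a nonzero
  integer determinant of two orbit vectors is at least 1 in absolute value. Roots of unity matter
  only for determinant 1 or -1 and for integer eigenvectors. The exponent 3/2 is counted as follows.
  Cauchy-Schwarz over \<open>k\<close> dyadic scales costs a factor \<open>k\<close>, and each of
  the \<open>k\<close> scales contributes a constant times \<open>2 ^ k\<close>. Dividing
  \<open>k ^ 2 * 2 ^ k\<close> by the square of the target rate, \<open>2 ^ k\<close> times
  \<open>k powr (3 + 2 * \<eta>)\<close>, leaves \<open>k powr (- 1 - 2 * \<eta>)\<close>, which is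
  summable. Integrals of characters give both analytic inputs: invariance of Lebesgue measure, and
  completeness of the characters in L2, which reduces the variance bound to trigonometric
  polynomials.\<close>

definition norm_sq :: "int^2 \<Rightarrow> int" where
  "norm_sq \<xi> = (\<xi> $ 1)\<^sup>2 + (\<xi> $ 2)\<^sup>2"

lemma norm_real_vec: "(norm (real_vec \<xi>))\<^sup>2 = of_int (norm_sq \<xi>)"
  by (simp add: real_vec_def norm_sq_def norm_vec_def L2_set_def sum_2)

lemma norm_sq_nonneg: "norm_sq \<xi> \<ge> 0"
  by (simp add: norm_sq_def)

lemma norm_sq_pos: "\<xi> \<noteq> 0 \<Longrightarrow> norm_sq \<xi> \<ge> 1"
proof -
  assume "\<xi> \<noteq> 0"
  then have "\<xi> $ 1 \<noteq> 0 \<or> \<xi> $ 2 \<noteq> 0"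
    by (simp add: vec_eq_iff forall_2)
  then have "norm_sq \<xi> > 0"
    unfolding norm_sq_def by (metis sum_power2_gt_zero_iff)
  then show ?thesis by simp
qed

lemma norm_real_vec_ge_1: "\<xi> \<noteq> 0 \<Longrightarrow> norm (real_vec \<xi>) \<ge> 1"
  using norm_sq_pos[of \<xi>] norm_real_vec[of \<xi>]
  by (intro power2_le_imp_le[of 1]) auto

lemma matrix_vector_2:
  fixes B :: "'a::comm_ring_1^2^2"
  shows "(B *v \<xi>) $ 1 = B $ 1 $ 1 * \<xi> $ 1 + B $ 1 $ 2 * \<xi> $ 2"
    and "(B *v \<xi>) $ 2 = B $ 2 $ 1 * \<xi> $ 1 + B $ 2 $ 2 * \<xi> $ 2"
  by (simp_all add: matrix_vector_mult_def sum_2)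

lemma vec2_eq_iff: "(v :: 'a^2) = w \<longleftrightarrow> v $ 1 = w $ 1 \<and> v $ 2 = w $ 2"
  by (simp add: vec_eq_iff forall_2)

lemma matrix_vector_scalar_2:
  fixes B :: "'a::comm_ring_1^2^2"
  shows "B *v (c *s \<xi>) = c *s (B *v \<xi>)"
  by (simp add: vec2_eq_iff matrix_vector_2 algebra_simps)

text \<open>The eigenvalue hypothesis is passed on through the zeros of this polynomial: the orbits
  belong to the transpose of \<open>A\<close>, and the polynomial is the same for both
  (\<open>char_poly_2_transpose\<close>).\<close>

definition char_poly_2 :: "int^2^2 \<Rightarrow> complex \<Rightarrow> complex" where
  "char_poly_2 B z = z\<^sup>2 - of_int (trace B) * z + of_int (det B)"

lemma trace_2: "trace (B :: 'a::comm_semiring_1^2^2) = B $ 1 $ 1 + B $ 2 $ 2"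
  by (simp add: trace_def sum_2)

text \<open>Explicit eigenvectors: \<open>(b, z - a)\<close> and \<open>(z - e, c)\<close> both
  work, and if both vanish then the matrix is scalar.\<close>

lemma char_poly_2_root_imp_eigenvalue:
  assumes "char_poly_2 B z = 0"
  shows "complex_eigenvalue B z"
proof -
  define a b c e where "a = (of_int (B $ 1 $ 1) :: complex)" and "b = (of_int (B $ 1 $ 2) :: complex)"
    and "c = (of_int (B $ 2 $ 1) :: complex)" and "e = (of_int (B $ 2 $ 2) :: complex)"
  note defs = a_def b_def c_def e_def
  have p: "(z - a) * (z - e) = b * c"
    using assms by (simp add: char_poly_2_def trace_2 det_2 defs power2_eq_square algebra_simps)
  have eig: "complex_eigenvalue B z" if "a * v1 + b * v2 = z * v1" "c * v1 + e * v2 = z * v2"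
      "v1 \<noteq> 0 \<or> v2 \<noteq> 0" for v1 v2
    unfolding complex_eigenvalue_def
    using that by (intro exI[of _ "vector [v1, v2]"])
      (auto simp: vec2_eq_iff matrix_vector_2 map_matrix_def defs)
  consider "b \<noteq> 0 \<or> z \<noteq> a" | "c \<noteq> 0 \<or> z \<noteq> e" | "b = 0" "c = 0" "z = a" "z = e" by blast
  then show ?thesis
  proof cases
    case 1
    then show ?thesis using p by (intro eig[of b "z - a"]) (auto simp: algebra_simps)
  next
    case 2
    then show ?thesis using p by (intro eig[of "z - e" c]) (auto simp: algebra_simps)
  next
    case 3
    then show ?thesis by (intro eig[of 1 0]) auto
  qed
qed

lemma char_poly_2_has_root: "\<exists>z. char_poly_2 B z = 0"
proof -
  define t d s where "t = (of_int (trace B) :: complex)" and "d = (of_int (det B) :: complex)"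
    and "s = csqrt (t\<^sup>2 - 4 * d)"
  have "s\<^sup>2 = t\<^sup>2 - 4 * d" by (simp add: s_def)
  then have "char_poly_2 B ((t + s) / 2) = 0"
    by (simp add: char_poly_2_def flip: t_def d_def) (simp add: field_simps power2_eq_square; algebra)
  then show ?thesis ..
qed

section \<open>Wedge products along orbits and Lucas sequences\<close>

definition wedge :: "int^2 \<Rightarrow> int^2 \<Rightarrow> int" where
  "wedge \<xi> \<zeta> = \<xi> $ 1 * \<zeta> $ 2 - \<xi> $ 2 * \<zeta> $ 1"

text \<open>Lagrange's identity: the defect is the square of the scalar product.\<close>

lemma wedge_squared_le: "(wedge \<xi> \<zeta>)\<^sup>2 \<le> norm_sq \<xi> * norm_sq \<zeta>"
proof -
  have "norm_sq \<xi> * norm_sq \<zeta> = (wedge \<xi> \<zeta>)\<^sup>2 + (\<xi> $ 1 * \<zeta> $ 1 + \<xi> $ 2 * \<zeta> $ 2)\<^sup>2"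
    by (simp add: norm_sq_def wedge_def power2_eq_square algebra_simps)
  then show ?thesis by simp
qed

lemma wedge_mult: "wedge (B *v \<xi>) (B *v \<zeta>) = det B * wedge \<xi> \<zeta>"
  by (simp add: wedge_def matrix_vector_2 det_2 algebra_simps)

text \<open>The Lucas sequence of the first kind. It is the coefficient of \<open>B\<close> when the
  n-th power of a matrix \<open>B\<close> with trace \<open>t\<close> and determinant
  \<open>d\<close> is reduced by Cayley-Hamilton to a combination of \<open>B\<close> and the
  identity.\<close>

fun lucas :: "int \<Rightarrow> int \<Rightarrow> nat \<Rightarrow> int" where
  "lucas t d 0 = 0"
| "lucas t d (Suc 0) = 1"
| "lucas t d (Suc (Suc n)) = t * lucas t d (Suc n) - d * lucas t d n"

lemma cayley_hamilton_2:
  fixes B :: "int^2^2"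
  shows "(B *v (B *v \<xi>)) $ i = trace B * (B *v \<xi>) $ i - det B * \<xi> $ i"
  by (rule forall_2[THEN iffD2, rule_format])
    (simp add: matrix_vector_2 trace_2 det_2 algebra_simps)

text \<open>By Cayley-Hamilton and linearity of \<open>wedge\<close> in its second argument, both
  sides obey the same two-step recurrence with the same initial values.\<close>

lemma wedge_iterate:
  "wedge \<xi> (((*v) B ^^ k) \<xi>) = lucas (trace B) (det B) k * wedge \<xi> (B *v \<xi>)"
proof (induction "trace B" "det B" k rule: lucas.induct)
  case (3 k)
  have "wedge \<xi> (((*v) B ^^ Suc (Suc k)) \<xi>)
      = trace B * wedge \<xi> (((*v) B ^^ Suc k) \<xi>) - det B * wedge \<xi> (((*v) B ^^ k) \<xi>)"
    by (simp add: wedge_def cayley_hamilton_2 algebra_simps)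
  then show ?case using 3 by (simp add: algebra_simps)
qed (simp_all add: wedge_def)

text \<open>Doubling over two steps multiplies the square by 4, which matches two more powers of 2;
  hence the induction in steps of two. The factor 4 covers the starting values 1 and
  \<open>t\<close>.\<close>

lemma power_le_lucas_squared:
  assumes step: "\<And>n. \<bar>lucas t d (Suc (Suc (Suc n)))\<bar> \<ge> 2 * \<bar>lucas t d (Suc n)\<bar>" and "t \<noteq> 0"
  shows "2 ^ Suc k \<le> 4 * (lucas t d (Suc k))\<^sup>2"
proof (induction k rule: induct_nat_012)
  case 1
  have "\<bar>t\<bar> \<ge> 1" using \<open>t \<noteq> 0\<close> by simp
  then have "t\<^sup>2 \<ge> 1" using one_le_power[of "\<bar>t\<bar>" 2] by simp
  then show ?case by simp
next
  case (ge2 n)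
  have "(2 * \<bar>lucas t d (Suc n)\<bar>)\<^sup>2 \<le> \<bar>lucas t d (Suc (Suc (Suc n)))\<bar>\<^sup>2"
    using step[of n] by (intro power_mono) auto
  then show ?case using ge2(1) by (simp add: power_mult_distrib del: lucas.simps)
qed simp

text \<open>By induction the subtracted term \<open>lucas t 1 n\<close> is at most half of
  \<open>lucas t 1 (Suc n)\<close> in absolute value, so a factor of at least 3 still leaves
  2.\<close>

lemma lucas_growth_det_1:
  assumes "\<bar>t\<bar> \<ge> 3"
  shows "\<bar>lucas t 1 (Suc n)\<bar> \<ge> 2 * \<bar>lucas t 1 n\<bar>"
proof (induction n)
  case (Suc n)
  have "\<bar>t * lucas t 1 (Suc n)\<bar> \<ge> 3 * \<bar>lucas t 1 (Suc n)\<bar>"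
    using assms by (simp add: abs_mult mult_right_mono)
  then show ?case using Suc by simp
qed simp

text \<open>The two terms that the recurrence adds never have opposite signs (\<open>sgn\<close>),
  so nothing cancels and the growth is at least that of Fibonacci numbers.\<close>

lemma lucas_growth_det_minus_1:
  assumes "t \<noteq> 0"
  shows "\<bar>lucas t (-1) (Suc (Suc n))\<bar> \<ge> \<bar>lucas t (-1) (Suc n)\<bar> + \<bar>lucas t (-1) n\<bar>"
proof -
  have sgn: "t * lucas t (-1) (Suc n) * lucas t (-1) n \<ge> 0" for n
  proof (induction n)
    case (Suc n)
    have "t * lucas t (-1) (Suc (Suc n)) * lucas t (-1) (Suc n)
        = (t * lucas t (-1) (Suc n))\<^sup>2 + t * lucas t (-1) (Suc n) * lucas t (-1) n"
      by (simp add: power2_eq_square algebra_simps)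
    then show ?case using Suc by simp
  qed simp
  have "\<bar>t * lucas t (-1) (Suc n) + lucas t (-1) n\<bar> = \<bar>t * lucas t (-1) (Suc n)\<bar> + \<bar>lucas t (-1) n\<bar>"
    using sgn[of n] unfolding zero_le_mult_iff[of "t * _"] by linarith
  moreover have "\<bar>t * lucas t (-1) (Suc n)\<bar> \<ge> \<bar>lucas t (-1) (Suc n)\<bar>"
    using assms mult_right_mono[of 1 "\<bar>t\<bar>" "\<bar>lucas t (-1) (Suc n)\<bar>"] by (simp add: abs_mult)
  ultimately show ?thesis by simp
qed

text \<open>The excluded characteristic polynomials are products of cyclotomic ones: orders 4, 6 and
  3 for traces 0, 1 and -1, a double root 1 or -1 for traces 2 and -2, and \<open>z ^ 2 - 1\<close>
  for determinant -1.\<close>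

lemma trace_bound_of_no_root_of_unity:
  assumes nr: "\<And>z. root_of_unity z \<Longrightarrow> char_poly_2 B z \<noteq> 0"
  shows "det B = 1 \<Longrightarrow> \<bar>trace B\<bar> \<ge> 3" and "det B = -1 \<Longrightarrow> trace B \<noteq> 0"
proof -
  obtain z where z: "char_poly_2 B z = 0" using char_poly_2_has_root by blast
  have no: "z ^ n \<noteq> 1" if "n > 0" for n
    using nr[of z] z that unfolding root_of_unity_def by blast
  show "\<bar>trace B\<bar> \<ge> 3" if d: "det B = 1"
  proof (rule ccontr)
    assume "\<not> 3 \<le> \<bar>trace B\<bar>"
    then consider "trace B = 0" | "trace B = 1" | "trace B = -1" | "trace B = 2" | "trace B = -2"
      by linarith
    then show False
    proof cases
      case 1
      then have "z\<^sup>2 = -1" using z d by (simp add: char_poly_2_def eq_neg_iff_add_eq_0)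
      then have "z ^ 4 = 1" using power_mult[of z 2 2] by simp
      then show ?thesis using no[of 4] by simp
    next
      case 2
      then have "z\<^sup>2 = z - 1" using z d by (simp add: char_poly_2_def algebra_simps add_eq_0_iff)
      then have "z ^ 3 = -1" by algebra
      then have "z ^ 6 = 1" using power_mult[of z 3 2] by simp
      then show ?thesis using no[of 6] by simp
    next
      case 3
      then have "z\<^sup>2 + z + 1 = 0" using z d by (simp add: char_poly_2_def)
      then have "z\<^sup>2 = - z - 1" by algebra
      then have "z ^ 3 = 1" by algebra
      then show ?thesis using no[of 3] by simp
    next
      case 4
      then have "(z - 1)\<^sup>2 = 0" using z d by (simp add: char_poly_2_def power2_eq_square algebra_simps)
      then show ?thesis using no[of 1] by simp
    next
      case 5
      then have "(z + 1)\<^sup>2 = 0" using z d by (simp add: char_poly_2_def power2_eq_square algebra_simps)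
      then have "z = -1" by (simp add: eq_neg_iff_add_eq_0)
      then show ?thesis using no[of 2] by simp
    qed
  qed
  show "trace B \<noteq> 0" if d: "det B = -1"
  proof
    assume "trace B = 0"
    then show False using z d no[of 2] by (simp add: char_poly_2_def)
  qed
qed

text \<open>Dividing \<open>\<xi>\<close> by the gcd of its entries gives a primitive vector in the
  same direction, whose Bezout coefficients exhibit the eigenvalue as an integer.\<close>

lemma integer_eigenvalue:
  assumes "wedge \<xi> (B *v \<xi>) = 0"
  shows "\<exists>m. \<forall>i. (B *v \<xi>) $ i = m * \<xi> $ i"
proof (cases "\<xi> = 0")
  case False
  define g where "g = gcd (\<xi> $ 1) (\<xi> $ 2)"
  have "g \<noteq> 0" using False by (auto simp: g_def vec2_eq_iff)
  obtain x y where xy: "\<xi> $ 1 = g * x" "\<xi> $ 2 = g * y"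
    unfolding g_def by (meson dvd_def gcd_dvd1 gcd_dvd2)
  obtain u v where "u * \<xi> $ 1 + v * \<xi> $ 2 = g" using bezout_int unfolding g_def by blast
  then have "g * (u * x + v * y) = g * 1" by (simp add: xy algebra_simps)
  then have uv: "u * x + v * y = 1" using \<open>g \<noteq> 0\<close> by simp
  define x' y' where "x' = B $ 1 $ 1 * x + B $ 1 $ 2 * y" and "y' = B $ 2 $ 1 * x + B $ 2 $ 2 * y"
  have B: "(B *v \<xi>) $ 1 = g * x'" "(B *v \<xi>) $ 2 = g * y'"
    by (simp_all add: matrix_vector_2 xy x'_def y'_def algebra_simps)
  have "g * g * (x * y') = g * g * (y * x')"
    using assms unfolding wedge_def B xy by (simp add: algebra_simps)
  then have w: "x * y' = y * x'" using \<open>g \<noteq> 0\<close> by simp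
  \<comment> \<open>Forced: pair the desired \<open>(x', y') = m (x, y)\<close> with
    \<open>(u, v)\<close> and use \<open>u * x + v * y = 1\<close>.\<close>
  define m where "m = u * x' + v * y'"
  have "m * x = x'" "m * y = y'"
    unfolding m_def using uv w by algebra+
  then show ?thesis
    by (intro exI[of _ m]) (simp add: forall_2 B xy mult.left_commute flip: mult.assoc)
qed (simp add: matrix_vector_mult_def)

lemma integer_eigenvalue_root:
  assumes "\<And>i. (B *v \<xi>) $ i = m * \<xi> $ i" "\<xi> \<noteq> 0"
  shows "char_poly_2 B (of_int m) = 0"
proof -
  obtain i where i: "\<xi> $ i \<noteq> 0" using assms(2) by (auto simp: vec_eq_iff)
  have "(B *v (B *v \<xi>)) $ i = m * (m * \<xi> $ i)"
  proof -
    have "B *v \<xi> = m *s \<xi>" using assms(1) by (simp add: vec_eq_iff)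
    then have "B *v (B *v \<xi>) = m *s (m *s \<xi>)" by (metis matrix_vector_scalar_2)
    then show ?thesis by simp
  qed
  then have "(m * m - trace B * m + det B) * \<xi> $ i = 0"
    using cayley_hamilton_2[of B \<xi> i] assms(1)[of i] by (simp add: algebra_simps)
  then have "m * m - trace B * m + det B = 0" using i by simp
  then show ?thesis
    unfolding char_poly_2_def power2_eq_square
    by (metis of_int_0 of_int_add of_int_diff of_int_mult)
qed

text \<open>The integral form \<open>q \<xi> = wedge \<xi> (B \<xi>)\<close> satisfies \<open>q (B \<xi>) = det B * q \<xi>\<close> and vanishes only on
  eigenvectors with integer eigenvalue. Where it does not vanish, growth comes from \<open>q\<close> itself if
  \<open>\<bar>det B\<bar> \<ge> 2\<close>, and from \<open>wedge \<xi> (B\<^sup>k \<xi>)\<close>, a Lucas number times \<open>q \<xi>\<close>, if \<open>\<bar>det B\<bar> = 1\<close>.\<close>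

lemma orbit_growth_int:
  assumes "det B \<noteq> 0" and nr: "\<And>z. root_of_unity z \<Longrightarrow> char_poly_2 B z \<noteq> 0"
  shows "\<exists>C\<ge>1. \<forall>\<xi> k. \<xi> \<noteq> 0 \<longrightarrow> 2 ^ k \<le> C * (norm_sq \<xi> * norm_sq (((*v) B ^^ k) \<xi>))"
proof -
  define q where "q \<xi> = wedge \<xi> (B *v \<xi>)" for \<xi>
  \<comment> \<open>The coefficients of the quadratic form \<open>q\<close> bound it by a multiple
    of \<open>norm_sq\<close>; the added 4 pays for the factor 4 in the Lucas estimate.\<close>
  define C where "C = \<bar>B $ 2 $ 1\<bar> + \<bar>B $ 2 $ 2 - B $ 1 $ 1\<bar> + \<bar>B $ 1 $ 2\<bar> + 4"
  have q_le: "\<bar>q \<xi>\<bar> \<le> C * norm_sq \<xi>" for \<xi>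
  proof -
    define x y where "x = \<xi> $ 1" and "y = \<xi> $ 2"
    have "q \<xi> = B $ 2 $ 1 * x\<^sup>2 + (B $ 2 $ 2 - B $ 1 $ 1) * (x * y) - B $ 1 $ 2 * y\<^sup>2"
      by (simp add: q_def wedge_def matrix_vector_2 x_def y_def power2_eq_square algebra_simps)
    also have "\<bar>\<dots>\<bar> \<le> \<bar>B $ 2 $ 1\<bar> * \<bar>x\<^sup>2\<bar> + \<bar>B $ 2 $ 2 - B $ 1 $ 1\<bar> * \<bar>x * y\<bar> + \<bar>B $ 1 $ 2\<bar> * \<bar>y\<^sup>2\<bar>"
      unfolding abs_mult[symmetric] by linarith
    also have "\<dots> \<le> \<bar>B $ 2 $ 1\<bar> * norm_sq \<xi> + \<bar>B $ 2 $ 2 - B $ 1 $ 1\<bar> * norm_sq \<xi> + \<bar>B $ 1 $ 2\<bar> * norm_sq \<xi>"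
    proof -
      have "\<bar>x * y\<bar> \<le> x\<^sup>2 + y\<^sup>2"
        using zero_le_power2[of "\<bar>x\<bar> - \<bar>y\<bar>"] zero_le_mult_iff[of "\<bar>x\<bar>" "\<bar>y\<bar>"]
        unfolding power2_diff abs_mult power2_abs by linarith
      then show ?thesis
        by (intro add_mono mult_left_mono) (auto simp: norm_sq_def x_def y_def)
    qed
    also have "\<dots> \<le> C * norm_sq \<xi>"
      by (simp add: C_def algebra_simps norm_sq_def)
    finally show ?thesis .
  qed
  have C: "C \<ge> 4" by (simp add: C_def)
  have "2 ^ k \<le> C * (norm_sq \<xi> * norm_sq (((*v) B ^^ k) \<xi>))" if "\<xi> \<noteq> 0" for \<xi> k
  proof (cases "q \<xi> = 0")
    case True
    then obtain m where m: "\<And>i. (B *v \<xi>) $ i = m * \<xi> $ i"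
      using integer_eigenvalue unfolding q_def by blast
    have root: "char_poly_2 B (of_int m) = 0" using integer_eigenvalue_root[OF m that] .
    \<comment> \<open>The integer eigenvalue is neither 1 nor -1 by the hypothesis on roots of
      unity, nor 0 by the determinant, so it is at least 2 in absolute value.\<close>
    have "root_of_unity 1" "root_of_unity (-1)"
      unfolding root_of_unity_def by (auto intro: exI[of _ "2::nat"])
    then have "m \<noteq> 1" "m \<noteq> -1"
      using nr[of 1] nr[of "-1"] root by auto
    moreover have "m \<noteq> 0"
      using root assms(1) by (auto simp: char_poly_2_def)
    ultimately have m2: "\<bar>m\<bar> \<ge> 2" by linarith
    have it: "(((*v) B ^^ k) \<xi>) $ i = m ^ k * \<xi> $ i" for i
    proof (induction k arbitrary: i)
      case (Suc k)
      have "((*v) B ^^ k) \<xi> = m ^ k *s \<xi>" using Suc by (simp add: vec_eq_iff)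
      then have "((*v) B ^^ Suc k) \<xi> = m ^ k *s (B *v \<xi>)"
        by (metis comp_apply funpow.simps(2) matrix_vector_scalar_2)
      then show ?case by (simp add: m mult.left_commute del: funpow.simps)
    qed simp
    have n1: "norm_sq \<xi> \<ge> 1" using norm_sq_pos[OF that] .
    have "(2::int) ^ k \<le> 4 ^ k" by (intro power_mono) auto
    also have "\<dots> \<le> (m\<^sup>2) ^ k"
      using power_mono[OF m2, of 2] by (intro power_mono) auto
    also have "\<dots> \<le> (m\<^sup>2) ^ k * norm_sq \<xi>"
      using n1 by (simp add: mult_le_cancel_left1)
    also have "\<dots> = norm_sq (((*v) B ^^ k) \<xi>)"
      by (simp add: norm_sq_def it algebra_simps power_mult_distrib flip: power_mult)
    also have "\<dots> \<le> C * norm_sq \<xi> * norm_sq (((*v) B ^^ k) \<xi>)"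
    proof -
      have "C * norm_sq \<xi> \<ge> 1" using n1 C by (smt (verit) mult_le_cancel_right1)
      then show ?thesis using mult_right_mono[OF _ norm_sq_nonneg] by fastforce
    qed
    finally show ?thesis by (simp add: mult.assoc)
  next
    case False
    show ?thesis
    proof (cases "\<bar>det B\<bar> = 1")
      case False
      have n1: "norm_sq \<xi> \<ge> 1" using norm_sq_pos[OF that] .
      have it: "q (((*v) B ^^ k) \<xi>) = det B ^ k * q \<xi>"
        by (induction k) (simp_all add: q_def wedge_mult)
      have "(2::int) ^ k \<le> \<bar>det B\<bar> ^ k" using False assms(1) by (intro power_mono) auto
      \<comment> \<open>Integrality enters: the nonzero integer \<open>q \<xi>\<close> has absolute
        value at least 1.\<close>
      also have "\<dots> \<le> \<bar>det B\<bar> ^ k * \<bar>q \<xi>\<bar>" 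
        using mult_left_mono[of 1 "\<bar>q \<xi>\<bar>" "\<bar>det B\<bar> ^ k"] \<open>q \<xi> \<noteq> 0\<close> by simp
      also have "\<dots> = \<bar>q (((*v) B ^^ k) \<xi>)\<bar>" by (simp add: it abs_mult power_abs)
      also have "\<dots> \<le> C * norm_sq (((*v) B ^^ k) \<xi>)" by (rule q_le)
      also have "\<dots> \<le> C * (norm_sq \<xi> * norm_sq (((*v) B ^^ k) \<xi>))"
        using n1 C mult_right_mono[OF n1 norm_sq_nonneg[of "((*v) B ^^ k) \<xi>"]]
        by (intro mult_left_mono) auto
      finally show ?thesis .
    next
      case True
      define L where "L = lucas (trace B) (det B)"
      have L: "2 ^ Suc j \<le> 4 * (L (Suc j))\<^sup>2" for j
      proof -
        consider "det B = 1" | "det B = -1" using True by linarith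
        then show ?thesis
        proof cases
          case 1
          have t: "\<bar>trace B\<bar> \<ge> 3" using trace_bound_of_no_root_of_unity(1)[OF nr 1] by blast
          show ?thesis unfolding L_def 1
          proof (rule power_le_lucas_squared)
            show "2 * \<bar>lucas (trace B) 1 (Suc n)\<bar> \<le> \<bar>lucas (trace B) 1 (Suc (Suc (Suc n)))\<bar>" for n
              using lucas_growth_det_1[OF t, of "Suc n"] lucas_growth_det_1[OF t, of "Suc (Suc n)"]
              by linarith
          qed (use t in auto)
        next
          case 2
          have t: "trace B \<noteq> 0" using trace_bound_of_no_root_of_unity(2)[OF nr 2] by blast
          show ?thesis unfolding L_def 2
          proof (rule power_le_lucas_squared)
            show "2 * \<bar>lucas (trace B) (-1) (Suc n)\<bar> \<le> \<bar>lucas (trace B) (-1) (Suc (Suc (Suc n)))\<bar>" for n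
              using lucas_growth_det_minus_1[OF t, of "Suc n"] lucas_growth_det_minus_1[OF t, of n]
              by linarith
          qed (use t in auto)
        qed
      qed
      show ?thesis
      proof (cases k)
        case 0
        \<comment> \<open>The Lucas number of index 0 vanishes, so time 0 is treated
          directly.\<close>
        have "1 * 1 \<le> C * (norm_sq \<xi> * norm_sq \<xi>)"
        proof (intro mult_mono)
          show "1 \<le> norm_sq \<xi> * norm_sq \<xi>"
            using norm_sq_pos[OF that] by (smt (verit) mult_le_cancel_right1)
        qed (use C in auto)
        then show ?thesis using 0 by simp
      next
        case (Suc j)
        have "(2::int) ^ k \<le> 4 * (L k)\<^sup>2" using L Suc by simp
        also have "\<dots> \<le> 4 * ((L k)\<^sup>2 * (q \<xi>)\<^sup>2)"
        proof -
          have "(q \<xi>)\<^sup>2 \<ge> 1" using zero_less_power2[of "q \<xi>"] \<open>q \<xi> \<noteq> 0\<close> by linarith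
          then show ?thesis using mult_left_mono[of 1 "(q \<xi>)\<^sup>2" "(L k)\<^sup>2"] by simp
        qed
        also have "\<dots> = 4 * (wedge \<xi> (((*v) B ^^ k) \<xi>))\<^sup>2"
          by (simp add: wedge_iterate L_def q_def power_mult_distrib)
        also have "\<dots> \<le> C * (norm_sq \<xi> * norm_sq (((*v) B ^^ k) \<xi>))"
          using C wedge_squared_le by (intro mult_mono) (auto simp: norm_sq_nonneg)
        finally show ?thesis .
      qed
    qed
  qed
  then show ?thesis using C by (intro exI[of _ C]) auto
qed

section \<open>Inverse weights along orbits\<close>

definition log_weight :: "real \<Rightarrow> int^2 \<Rightarrow> real" where
  "log_weight \<delta> \<xi> = ln (1 + norm (real_vec \<xi>)) powr (1 + \<delta>)"

lemma log_weight_pos: "\<xi> \<noteq> 0 \<Longrightarrow> log_weight \<delta> \<xi> > 0"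
  using norm_real_vec_ge_1[of \<xi>] by (auto simp: log_weight_def)

text \<open>If \<open>B\<close> kills \<open>\<zeta>\<close>, Cayley-Hamilton leaves
  \<open>det B\<close> times \<open>\<zeta>\<close> equal to 0; this stands in for inverting
  \<open>B\<close> over the rationals.\<close>

lemma iterate_nonzero:
  fixes B :: "int^2^2"
  assumes "det B \<noteq> 0" "\<xi> \<noteq> 0"
  shows "((*v) B ^^ k) \<xi> \<noteq> 0"
proof (induction k)
  case (Suc k)
  define \<zeta> where "\<zeta> = ((*v) B ^^ k) \<xi>"
  have "det B *s \<zeta> = 0" if "B *v \<zeta> = 0"
    using cayley_hamilton_2[of B \<zeta>] that by (simp add: vec_eq_iff matrix_vector_mult_def)
  then show ?case using Suc assms(1) by (auto simp: \<zeta>_def vec_eq_iff)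
qed (use assms in simp)

text \<open>The orbit grows exponentially in both directions away from its shortest vector, so that the
  weights along it grow at least linearly in the distance (in time) from that vector.\<close>

lemma orbit_weight_sum_bounded:
  assumes "det B \<noteq> 0" and nr: "\<And>z. root_of_unity z \<Longrightarrow> char_poly_2 B z \<noteq> 0"
    and "\<delta> > 0"
  shows "\<exists>C. \<forall>\<xi> m. \<xi> \<noteq> 0 \<longrightarrow> (\<Sum>i\<le>m. 1 / log_weight \<delta> (((*v) B ^^ i) \<xi>)) \<le> C"
proof -
  obtain C0 where C0: "C0 \<ge> 1"
    "\<And>\<xi> k. \<xi> \<noteq> 0 \<Longrightarrow> 2 ^ k \<le> C0 * (norm_sq \<xi> * norm_sq (((*v) B ^^ k) \<xi>))"
    using orbit_growth_int[OF assms(1) nr] by blast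
  \<comment> \<open>With \<open>L = ln (1 + r i)\<close>, comparison with the shortest vector gives
    \<open>D i * ln 2 \<le> ln C0 + 4 * L\<close>. As \<open>L \<ge> ln 2\<close>, the term
    \<open>ln C0\<close> is at most \<open>ln C0 / ln 2\<close> times \<open>L\<close>, and one more
    \<open>L\<close> turns \<open>D i\<close> into \<open>D i + 1\<close>; hence 5.\<close>
  define \<kappa> where "\<kappa> = ln 2 / (ln (of_int C0) / ln 2 + 5 :: real)"
  have "ln (of_int C0 :: real) \<ge> 0" using C0(1) by simp
  then have \<kappa>: "\<kappa> > 0" by (simp add: \<kappa>_def add_nonneg_pos)
  define h where "h j = real (Suc j) powr (- (1 + \<delta>))" for j
  have h0: "h j \<ge> 0" for j by (simp add: h_def)
  have "summable h"
    unfolding h_def using \<open>\<delta> > 0\<close>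
    by (subst summable_Suc_iff[of "\<lambda>n. real n powr (- (1 + \<delta>))"]) (simp add: summable_real_powr_iff)
  then have hsum: "sum h S \<le> suminf h" if "finite S" for S
    using that h0 by (intro sum_le_suminf) auto
  have main: "(\<Sum>i\<le>m. 1 / log_weight \<delta> (((*v) B ^^ i) \<xi>)) \<le> \<kappa> powr (- (1 + \<delta>)) * (2 * suminf h)"
    if "\<xi> \<noteq> 0" for \<xi> m
  proof -
    define r where "r i = norm (real_vec (((*v) B ^^ i) \<xi>))" for i
    have r1: "r i \<ge> 1" for i
      unfolding r_def by (intro norm_real_vec_ge_1 iterate_nonzero assms that)
    have grow: "2 ^ (j - i) \<le> of_int C0 * ((r i)\<^sup>2 * (r j)\<^sup>2)" if "i \<le> j" for i j
    proof -
      have "((*v) B ^^ j) \<xi> = ((*v) B ^^ (j - i)) (((*v) B ^^ i) \<xi>)"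
        using that by (simp flip: funpow_add[THEN fun_cong, unfolded comp_def])
      then have "2 ^ (j - i) \<le> C0 * (norm_sq (((*v) B ^^ i) \<xi>) * norm_sq (((*v) B ^^ j) \<xi>))"
        using C0(2)[of "((*v) B ^^ i) \<xi>" "j - i"] iterate_nonzero[OF assms(1) \<open>\<xi> \<noteq> 0\<close>] by simp
      then have "real_of_int (2 ^ (j - i)) \<le> of_int (C0 * (norm_sq (((*v) B ^^ i) \<xi>) * norm_sq (((*v) B ^^ j) \<xi>)))"
        by (rule of_int_le_iff[THEN iffD2])
      then show ?thesis by (simp add: r_def norm_real_vec)
    qed
    obtain i0 where i0: "i0 \<le> m" "\<And>i. i \<le> m \<Longrightarrow> r i0 \<le> r i"
      using arg_min_if_finite[of "{..m}" r] that
      by (metis atMost_iff empty_iff finite_atMost linorder_not_less order_refl)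
    define D where "D i = (if i < i0 then i0 - i else i - i0)" for i
    have "1 / log_weight \<delta> (((*v) B ^^ i) \<xi>) \<le> \<kappa> powr (- (1 + \<delta>)) * h (D i)" if "i \<le> m" for i
    proof -
      have "2 ^ D i \<le> of_int C0 * ((r i)\<^sup>2 * (r i0)\<^sup>2)"
        using grow[of i i0] grow[of i0 i] by (auto simp: D_def mult.commute)
      also have "\<dots> \<le> of_int C0 * ((r i)\<^sup>2 * (r i)\<^sup>2)"
        using C0(1) i0(2)[OF that] r1[of i0] by (intro mult_left_mono power_mono) auto
      also have "\<dots> = of_int C0 * r i ^ 4" by (simp add: flip: power_add)
      finally have "ln (2 ^ D i) \<le> ln (of_int C0 * r i ^ 4)"
        using C0(1) r1[of i] by (subst ln_le_cancel_iff) auto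
      then have 1: "real (D i) * ln 2 \<le> ln (of_int C0) + 4 * ln (r i)"
        using C0(1) r1[of i] by (simp add: ln_realpow ln_mult)
      define L where "L = ln (1 + r i)"
      have L2: "L \<ge> ln 2" and Lr: "ln (r i) \<le> L" using r1[of i] by (simp_all add: L_def)
      have "ln (of_int C0 :: real) * 1 \<le> ln (of_int C0) * (L / ln 2)"
        using L2 C0(1) by (intro mult_left_mono) auto
      then have "(1 + real (D i)) * ln 2 \<le> (ln (of_int C0) / ln 2 + 5) * L"
        using 1 Lr L2 by (simp add: algebra_simps)
      then have "\<kappa> * real (Suc (D i)) \<le> L"
        using \<open>ln (of_int C0 :: real) \<ge> 0\<close> unfolding \<kappa>_def
        by (simp add: field_simps add_nonneg_pos)
      then have "L powr (- (1 + \<delta>)) \<le> (\<kappa> * real (Suc (D i))) powr (- (1 + \<delta>))"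
        using \<kappa> \<open>\<delta> > 0\<close> by (intro powr_mono2') auto
      also have "\<dots> = \<kappa> powr (- (1 + \<delta>)) * h (D i)"
        using \<kappa> by (simp add: h_def powr_mult)
      finally show ?thesis
        unfolding log_weight_def L_def r_def by (simp only: powr_minus_divide)
    qed
    then have "(\<Sum>i\<le>m. 1 / log_weight \<delta> (((*v) B ^^ i) \<xi>)) \<le> (\<Sum>i\<le>m. \<kappa> powr (- (1 + \<delta>)) * h (D i))"
      by (intro sum_mono) auto
    also have "\<dots> = \<kappa> powr (- (1 + \<delta>)) * (\<Sum>i\<le>m. h (D i))"
      by (simp add: sum_distrib_left)
    \<comment> \<open>\<open>D\<close> is injective on each side of \<open>i0\<close> but not across
      it, so each side is compared with the full series; hence the factor 2.\<close>
    also have "(\<Sum>i\<le>m. h (D i)) = (\<Sum>i<i0. h (D i)) + (\<Sum>i\<in>{i0..m}. h (D i))"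
      using i0(1) by (subst sum.union_disjoint[symmetric]) (auto intro!: sum.cong)
    also have "(\<Sum>i<i0. h (D i)) = sum h (D ` {..<i0})"
      by (subst sum.reindex) (auto simp: inj_on_def D_def)
    also have "(\<Sum>i\<in>{i0..m}. h (D i)) = sum h (D ` {i0..m})"
      by (subst sum.reindex) (auto simp: inj_on_def D_def)
    also have "\<kappa> powr (- (1 + \<delta>)) * (sum h (D ` {..<i0}) + sum h (D ` {i0..m}))
        \<le> \<kappa> powr (- (1 + \<delta>)) * (2 * suminf h)"
      using hsum[of "D ` {..<i0}"] hsum[of "D ` {i0..m}"] by (intro mult_left_mono) auto
    finally show ?thesis .
  qed
  then show ?thesis by blast
qed

section \<open>Characters of the torus\<close>

interpretation torus: finite_measure torus
  by standard (simp add: emeasure_torus)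

lemma borel_measurable_torusI [measurable (raw)]:
  "g \<in> borel \<rightarrow>\<^sub>M N \<Longrightarrow> g \<in> torus \<rightarrow>\<^sub>M N"
  unfolding torus_def by (intro measurable_restrict_space1 measurable_completion) simp

definition character :: "int^2 \<Rightarrow> real^2 \<Rightarrow> complex" where
  "character \<xi> x = exp (2 * of_real pi * \<i> * of_real (x \<bullet> real_vec \<xi>))"

lemma character_cis: "character \<xi> x = cis (2 * pi * (x \<bullet> real_vec \<xi>))"
  by (simp add: character_def cis_conv_exp mult_ac)

lemma continuous_on_character: "continuous_on S (character \<xi>)"
  unfolding character_def by (intro continuous_intros)

lemma borel_measurable_character [measurable]: "character \<xi> \<in> borel \<rightarrow>\<^sub>M borel"
  by (intro borel_measurable_continuous_onI continuous_on_character)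

lemma norm_character [simp]: "norm (character \<xi> x) = 1"
  by (simp add: character_cis)

lemma cnj_character: "cnj (character \<xi> x) = character (- \<xi>) x"
proof -
  have "real_vec (- \<xi>) = - real_vec \<xi>" by (simp add: real_vec_def vec_eq_iff)
  then show ?thesis by (simp add: character_cis cis_cnj)
qed

lemma character_add: "character (\<xi> + \<zeta>) x = character \<xi> x * character \<zeta> x"
proof -
  have "real_vec (\<xi> + \<zeta>) = real_vec \<xi> + real_vec \<zeta>" by (simp add: real_vec_def vec_eq_iff)
  then show ?thesis by (simp add: character_cis cis_mult inner_add_right algebra_simps)
qed

lemma character_0 [simp]: "character 0 x = 1"
  by (simp add: character_def real_vec_def inner_vec_def)

lemma fourier_coeff_character:
  "fourier_coeff f \<xi> = (LINT x|torus. f x * cnj (character \<xi> x))"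
  unfolding fourier_coeff_def character_def by (simp add: exp_cnj)

text \<open>\<open>frac\<close> shifts coordinates by integers, whose pairing \<open>k\<close> with
  \<open>\<xi>\<close> is an integer that \<open>cis\<close> does not see; the linear part moves
  over to \<open>\<xi>\<close> as its transpose.\<close>

lemma character_torus_map:
  "character \<xi> (torus_map A x) = character (transpose A *v \<xi>) x"
proof -
  define y where "y = map_matrix of_int A *v x"
  have adj: "y \<bullet> real_vec \<xi> = x \<bullet> real_vec (transpose A *v \<xi>)"
    by (simp add: y_def inner_vec_def real_vec_def matrix_vector_mult_def map_matrix_def
        transpose_def sum_2 algebra_simps)
  define k where "k = (\<Sum>i\<in>UNIV. \<lfloor>y $ i\<rfloor> * \<xi> $ i)"
  have "torus_map A x \<bullet> real_vec \<xi> = y \<bullet> real_vec \<xi> - of_int k"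
    by (simp add: torus_map_def inner_vec_def real_vec_def y_def[symmetric] frac_def k_def
        sum_2 algebra_simps)
  then have "character \<xi> (torus_map A x) = cis (2 * pi * (y \<bullet> real_vec \<xi>)) / cis (2 * pi * of_int k)"
    by (simp only: character_cis cis_divide right_diff_distrib)
  also have "cis (2 * pi * of_int k) = 1"
    by (intro cis_multiple_2pi) auto
  finally show ?thesis by (simp add: adj character_cis)
qed

lemma character_torus_map_iterate:
  "character \<xi> ((torus_map A ^^ n) x) = character (((*v) (transpose A) ^^ n) \<xi>) x"
proof (induction n arbitrary: \<xi>)
  case (Suc n)
  have "character \<xi> ((torus_map A ^^ Suc n) x) = character (((*v) (transpose A) ^^ n) (transpose A *v \<xi>)) x"
    using Suc by (simp only: funpow.simps comp_apply character_torus_map)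
  then show ?case by (simp only: funpow_Suc_right comp_apply)
qed simp

section \<open>Measurability of the torus map\<close>

lemma borel_measurable_frac [measurable]: "(frac :: real \<Rightarrow> real) \<in> borel_measurable borel"
  unfolding frac_def by measurable

lemma borel_measurable_vec_lambda:
  fixes f :: "'a \<Rightarrow> 'n::finite \<Rightarrow> 'b::euclidean_space"
  assumes "\<And>i. (\<lambda>x. f x i) \<in> borel_measurable M"
  shows "(\<lambda>x. \<chi> i. f x i) \<in> borel_measurable M"
proof (subst borel_measurable_euclidean_space, safe)
  fix b :: "'b^'n" assume "b \<in> Basis"
  then obtain i u where "u \<in> Basis" "b = axis i u" by (auto simp: Basis_vec_def)
  then show "(\<lambda>x. (\<chi> i. f x i) \<bullet> b) \<in> borel_measurable M"
    using assms[of i] by (simp add: inner_axis)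
qed

lemma borel_measurable_vec_nth [measurable]: "(\<lambda>x :: 'b::euclidean_space^'n. x $ i) \<in> borel_measurable borel"
  by (intro borel_measurable_continuous_onI continuous_intros)

lemma borel_measurable_torus_map [measurable]: "torus_map A \<in> borel \<rightarrow>\<^sub>M borel"
  unfolding torus_map_def matrix_vector_mult_def map_matrix_def
  by (intro borel_measurable_vec_lambda) simp

lemma borel_measurable_torus_map_iterate [measurable]: "torus_map A ^^ n \<in> borel \<rightarrow>\<^sub>M borel"
  by (induction n) simp_all

section \<open>Integrals of characters\<close>

lemma integral_torus_Borel:
  fixes g :: "real^2 \<Rightarrow> complex"
  assumes [measurable]: "g \<in> borel_measurable borel"
  shows "integral\<^sup>L torus g = (LINT x|lborel. indicator {x. \<forall>i. 0 \<le> x $ i \<and> x $ i < 1} x *\<^sub>R g x)"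
  unfolding torus_def using unit_square_lebesgue
  by (simp add: integral_restrict_space integral_completion)

lemma integral_exp_period:
  assumes "k \<noteq> 0"
  shows "(LINT t|lborel. indicator {0..<1::real} t *\<^sub>R exp (2 * of_real pi * \<i> * of_real (t * of_int k))) = (0::complex)"
proof -
  define c where "c = 2 * of_real pi * \<i> * (of_int k :: complex)"
  have c: "c \<noteq> 0" using assms by (simp add: c_def)
  have "(LINT t|lborel. indicator {0..<1::real} t *\<^sub>R exp (2 * of_real pi * \<i> * of_real (t * of_int k)))
      = (LINT t|lborel. indicator {0..1} t *\<^sub>R exp (c * of_real t))"
  proof (rule integral_cong_AE)
    show "AE t in lborel. indicator {0..<1::real} t *\<^sub>R exp (2 * of_real pi * \<i> * of_real (t * of_int k))
        = indicator {0..1} t *\<^sub>R exp (c * of_real t)"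
      using AE_lborel_singleton[of "1::real"]
      by eventually_elim (auto split: split_indicator simp: c_def mult_ac)
  qed measurable
  also have "\<dots> = exp (c * of_real 1) / c - exp (c * of_real 0) / c"
    using c by (intro integral_FTC_Icc)
      (auto intro!: derivative_eq_intros continuous_intros has_vector_derivative_real_field)
  also have "exp (c * of_real 1) = 1"
    using exp_integer_2pi[of "of_int k"] by (simp add: c_def mult_ac)
  finally show ?thesis by simp
qed

text \<open>Fubini: together with the indicator of the square, the integrand is a product of
  functions \<open>\<phi> b\<close> of one coordinate each, and a coordinate in which
  \<open>\<xi>\<close> is nonzero integrates an exponential over whole periods.\<close>

lemma integral_character: "integral\<^sup>L torus (character \<xi>) = (if \<xi> = 0 then 1 else 0)"
proof (cases "\<xi> = 0")
  case True
  then have "character \<xi> = (\<lambda>_. 1)" by auto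
  then show ?thesis
    using emeasure_torus True by (simp add: measure_def)
next
  case False
  define \<phi> where "\<phi> b t = indicator {0..<1::real} t *\<^sub>R exp (2 * of_real pi * \<i> * of_real (t * (b \<bullet> real_vec \<xi>)))"
    for b :: "real^2" and t
  have int: "integrable lborel (\<phi> b)" for b
  proof (rule Bochner_Integration.integrable_bound[where f = "indicator {0..<1::real} :: real \<Rightarrow> real"])
    show "\<phi> b \<in> borel_measurable lborel" unfolding \<phi>_def by measurable
  qed (auto simp: \<phi>_def split: split_indicator)
  interpret product_sigma_finite "\<lambda>b :: real^2. lborel :: real measure" ..
  have \<phi>_prod: "indicator {x. \<forall>i. 0 \<le> x $ i \<and> x $ i < 1} x *\<^sub>R character \<xi> x = (\<Prod>b\<in>Basis. \<phi> b (x \<bullet> b))" for x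
  proof -
    have "(\<Prod>b\<in>Basis. \<phi> b (x \<bullet> b)) = of_real (\<Prod>b\<in>Basis. indicator {0..<1::real} (x \<bullet> b)) *
        (\<Prod>b\<in>Basis. exp (2 * of_real pi * \<i> * of_real ((x \<bullet> b) * (b \<bullet> real_vec \<xi>))))"
      by (simp add: \<phi>_def scaleR_conv_of_real prod.distrib)
    also have "(\<Prod>b\<in>Basis. exp (2 * of_real pi * \<i> * of_real ((x \<bullet> b) * (b \<bullet> real_vec \<xi>)))) = character \<xi> x"
      unfolding character_def
      by (subst exp_sum[symmetric])
        (simp_all add: euclidean_inner[of x "real_vec \<xi>"] inner_commute sum_distrib_left of_real_sum)
    also have "(\<Prod>b\<in>Basis. indicator {0..<1::real} (x \<bullet> b)) = (indicator {x. \<forall>i. 0 \<le> x $ i \<and> x $ i < 1} x :: real)"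
    proof -
      have "(\<Prod>b\<in>Basis. indicator {0..<1::real} (x \<bullet> b) :: real) = (if \<forall>b\<in>Basis. x \<bullet> b \<in> {0..<1} then 1 else 0)"
        by (auto simp: indicator_def)
      also have "(\<forall>b\<in>Basis. x \<bullet> b \<in> {0..<1}) \<longleftrightarrow> (\<forall>i. 0 \<le> x $ i \<and> x $ i < 1)"
        by (auto simp: Basis_vec_def inner_axis)
      finally show ?thesis by (simp add: indicator_def)
    qed
    finally show ?thesis by (simp add: scaleR_conv_of_real)
  qed
  have [measurable]: "\<phi> b \<in> borel_measurable borel" for b
    unfolding \<phi>_def by measurable
  have "integral\<^sup>L torus (character \<xi>) = (LINT x|lborel. (\<Prod>b\<in>Basis. \<phi> b (x \<bullet> b)))"
    by (simp add: integral_torus_Borel \<phi>_prod)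
  also have "\<dots> = integral\<^sup>L (Pi\<^sub>M Basis (\<lambda>_. lborel)) (\<lambda>y. \<Prod>b\<in>Basis. \<phi> b (y b))"
    by (subst lborel_eq, subst integral_distr) (auto intro!: Bochner_Integration.integral_cong prod.cong)
  also have "\<dots> = (\<Prod>b\<in>Basis. integral\<^sup>L lborel (\<phi> b))"
    by (intro product_integral_prod int) auto
  also have "\<dots> = 0"
  proof (rule prod_zero)
    obtain i where i: "\<xi> $ i \<noteq> 0" using False by (auto simp: vec_eq_iff)
    have "integral\<^sup>L lborel (\<phi> (axis i 1)) = 0"
      using integral_exp_period[OF i] by (simp add: \<phi>_def[abs_def] inner_axis' real_vec_def)
    then show "\<exists>b\<in>Basis. integral\<^sup>L lborel (\<phi> b) = 0"
      by (intro bexI[of _ "axis i 1"]) (auto simp: Basis_vec_def)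
  qed simp
  finally show ?thesis using False by simp
qed

section \<open>Trigonometric polynomials and invariance of Lebesgue measure\<close>

definition trig_polys :: "(real^2 \<Rightarrow> complex) set" where
  "trig_polys = {p. \<exists>F b. finite F \<and> p = (\<lambda>x. \<Sum>\<xi>\<in>F. b \<xi> * character \<xi> x)}"

text \<open>\<open>k\<close> may repeat frequencies; grouping by its fibres gives the form with
  distinct frequencies, to which orthogonality applies.\<close>

lemma sum_characters_collect:
  assumes "finite I"
  shows "(\<Sum>i\<in>I. c i * character (k i) x)
    = (\<Sum>\<xi>\<in>k ` I. (\<Sum>i\<in>{i\<in>I. k i = \<xi>}. c i) * character \<xi> x)"
  by (subst sum.image_gen[OF assms, of _ k]) (auto simp: sum_distrib_right intro!: sum.cong)

lemma trig_polysI: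
  assumes "finite I" "\<And>x. p x = (\<Sum>i\<in>I. c i * character (k i) x)"
  shows "p \<in> trig_polys"
proof -
  have eq: "p = (\<lambda>x. \<Sum>\<xi>\<in>k ` I. (\<Sum>i\<in>{i\<in>I. k i = \<xi>}. c i) * character \<xi> x)"
    using sum_characters_collect[OF assms(1), of c k] assms(2) by (intro ext) simp
  show ?thesis
    unfolding trig_polys_def
    by (intro CollectI exI conjI) (rule finite_imageI[OF assms(1)], rule eq)
qed

lemma trig_polysE:
  assumes "p \<in> trig_polys"
  obtains F b where "finite F" "p = (\<lambda>x. \<Sum>\<xi>\<in>F. b \<xi> * character \<xi> x)"
  using assms by (auto simp: trig_polys_def)

lemma trig_polys_character: "(\<lambda>x. c * character \<xi> x) \<in> trig_polys"
  by (rule trig_polysI[of "{()}" _ "\<lambda>_. c" "\<lambda>_. \<xi>"]) auto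

lemma trig_polys_const: "(\<lambda>x. c) \<in> trig_polys"
  using trig_polys_character[of c 0] by simp

lemma trig_polys_add:
  assumes "p \<in> trig_polys" "q \<in> trig_polys"
  shows "(\<lambda>x. p x + q x) \<in> trig_polys"
proof -
  obtain F b where "finite F" "p = (\<lambda>x. \<Sum>\<xi>\<in>F. b \<xi> * character \<xi> x)"
    using assms(1) by (rule trig_polysE)
  moreover obtain G c where "finite G" "q = (\<lambda>x. \<Sum>\<xi>\<in>G. c \<xi> * character \<xi> x)"
    using assms(2) by (rule trig_polysE)
  ultimately show ?thesis
    by (intro trig_polysI[of "F <+> G" _ "case_sum b c" "case_sum id id"]) (simp_all add: sum.Plus)
qed

lemma trig_polys_mult:
  assumes "p \<in> trig_polys" "q \<in> trig_polys"
  shows "(\<lambda>x. p x * q x) \<in> trig_polys"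
proof -
  obtain F b where "finite F" "p = (\<lambda>x. \<Sum>\<xi>\<in>F. b \<xi> * character \<xi> x)"
    using assms(1) by (rule trig_polysE)
  moreover obtain G c where "finite G" "q = (\<lambda>x. \<Sum>\<xi>\<in>G. c \<xi> * character \<xi> x)"
    using assms(2) by (rule trig_polysE)
  ultimately show ?thesis
    by (intro trig_polysI[of "F \<times> G" _ "\<lambda>(\<xi>, \<zeta>). b \<xi> * c \<zeta>" "\<lambda>(\<xi>, \<zeta>). \<xi> + \<zeta>"])
      (auto simp: sum_product sum.cartesian_product character_add mult_ac intro!: sum.cong)
qed

lemma trig_polys_sum:
  "(\<And>i. i \<in> I \<Longrightarrow> p i \<in> trig_polys) \<Longrightarrow> (\<lambda>x. \<Sum>i\<in>I. p i x) \<in> trig_polys"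
  by (induction I rule: infinite_finite_induct) (auto intro: trig_polys_const trig_polys_add)

lemma borel_measurable_trig_polys:
  assumes "p \<in> trig_polys" shows "p \<in> borel_measurable borel"
  using assms by (auto simp: trig_polys_def)

text \<open>The torus is embedded as a compact subset of \<open>\<complex>\<^sup>2\<close>, where Stone--Weierstrass is available.\<close>

definition circle_map :: "real^2 \<Rightarrow> complex^2" where
  "circle_map x = (\<chi> i. cis (2 * pi * x $ i))"

text \<open>A Borel inverse of \<open>circle_map\<close> on the fundamental domain. It jumps where
  an angle returns to 0, so it transports measurable sets but not continuity.\<close>

definition angle_map :: "complex^2 \<Rightarrow> real^2" where
  "angle_map z = (\<chi> i. Arg2pi (z $ i) / (2 * pi))"

lemma angle_map_circle_map: "x \<in> space torus \<Longrightarrow> angle_map (circle_map x) = x"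
  by (auto simp: angle_map_def circle_map_def space_torus vec_eq_iff cis_conv_exp Arg2pi_exp)

lemma borel_measurable_circle_map [measurable]: "circle_map \<in> borel \<rightarrow>\<^sub>M borel"
  unfolding circle_map_def cis_conv_exp by (intro borel_measurable_vec_lambda) measurable

lemma borel_measurable_Arg2pi [measurable]: "Arg2pi \<in> borel_measurable borel"
  unfolding borel_measurable_iff_greater using open_Arg2pi2pi_gt by auto

lemma borel_measurable_angle_map [measurable]: "angle_map \<in> borel \<rightarrow>\<^sub>M borel"
  unfolding angle_map_def by (intro borel_measurable_vec_lambda) measurable

lemma trig_polys_cos_sin:
  "(\<lambda>x. of_real (cos (2 * pi * x $ i))) \<in> trig_polys" "(\<lambda>x. of_real (sin (2 * pi * x $ i))) \<in> trig_polys"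
proof -
  have e: "character (axis i 1) x = cis (2 * pi * x $ i)" for x :: "real^2"
  proof -
    have "real_vec (axis i 1) = axis i 1" by (simp add: real_vec_def axis_def vec_eq_iff)
    then show ?thesis by (simp add: character_cis inner_axis)
  qed
  have e': "character (- axis i 1) x = cis (- (2 * pi * x $ i))" for x :: "real^2"
    using cnj_character[of "axis i 1" x] by (simp only: e cis_cnj)
  have "(\<lambda>x. 1/2 * character (axis i 1) x + 1/2 * character (- axis i 1) x) \<in> trig_polys"
    by (intro trig_polys_add trig_polys_character)
  moreover have "(\<lambda>x. 1/2 * character (axis i 1) x + 1/2 * character (- axis i 1) x)
      = (\<lambda>x. of_real (cos (2 * pi * x $ i)))"
    by (simp add: e e' fun_eq_iff complex_eq_iff)
  ultimately show "(\<lambda>x. of_real (cos (2 * pi * x $ i))) \<in> trig_polys" by simp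
  have "(\<lambda>x. (- \<i>/2) * character (axis i 1) x + \<i>/2 * character (- axis i 1) x) \<in> trig_polys"
    by (intro trig_polys_add trig_polys_character)
  moreover have "(\<lambda>x. (- \<i>/2) * character (axis i 1) x + \<i>/2 * character (- axis i 1) x)
      = (\<lambda>x. of_real (sin (2 * pi * x $ i)))"
    by (simp add: e e' fun_eq_iff complex_eq_iff)
  ultimately show "(\<lambda>x. of_real (sin (2 * pi * x $ i))) \<in> trig_polys" by simp
qed

text \<open>A real-linear functional is fixed by its values at \<open>axis i 1\<close> and
  \<open>axis i \<i>\<close>, so along \<open>circle_map\<close> it is a combination of cosines and
  sines; products and sums follow by closure.\<close>

lemma trig_polys_real_polynomial:
  assumes "real_polynomial_function g"
  shows "(\<lambda>x. of_real (g (circle_map x))) \<in> trig_polys"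
  using assms
proof induction
  case (linear f)
  interpret bounded_linear f by fact
  have rep: "f z = (\<Sum>i\<in>UNIV. f (axis i 1) * Re (z $ i) + f (axis i \<i>) * Im (z $ i))" for z :: "complex^2"
  proof -
    have "z = (\<Sum>i\<in>UNIV. Re (z $ i) *\<^sub>R axis i 1 + Im (z $ i) *\<^sub>R axis i \<i>)"
      by (simp add: vec_eq_iff axis_def complex_eq_iff sum_2 forall_2)
    then have "f z = f (\<Sum>i\<in>UNIV. Re (z $ i) *\<^sub>R axis i 1 + Im (z $ i) *\<^sub>R axis i \<i>)"
      by simp
    then show ?thesis by (simp add: sum add scaleR mult.commute)
  qed
  have "f (circle_map x) = (\<Sum>i\<in>UNIV. f (axis i 1) * cos (2 * pi * x $ i) + f (axis i \<i>) * sin (2 * pi * x $ i))" for x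
    using rep[of "circle_map x"] by (simp add: circle_map_def)
  then show ?case
    by (simp only: of_real_sum of_real_add of_real_mult)
      (intro trig_polys_sum trig_polys_add trig_polys_mult trig_polys_const trig_polys_cos_sin)
next
  case (const c)
  then show ?case by (rule trig_polys_const)
next
  case (add f g)
  from add.IH show ?case unfolding of_real_add by (rule trig_polys_add)
next
  case (mult f g)
  from mult.IH show ?case unfolding of_real_mult by (rule trig_polys_mult)
qed

text \<open>Each \<open>p n\<close> comes from a polynomial within \<open>1 / (n + 1)\<close> of the
  cutoff \<open>c n\<close>, which is 1 on \<open>C\<close> and decreases to 0 off it. Cutoffs lie
  in [0, 1], so 2 is a uniform bound for dominated convergence.\<close>

lemma trig_polys_approx_indicator:
  assumes "compact C"
  obtains p where "\<And>n. p n \<in> trig_polys" "\<And>n x. norm (p n x) \<le> 2"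
    "\<And>x. (\<lambda>n. p n x) \<longlonglongrightarrow> indicator C (circle_map x)"
proof (cases "C = {}")
  case True
  then show ?thesis using that[of "\<lambda>_ _. 0"] by (simp add: trig_polys_const)
next
  case False
  define c where "c n z = max 0 (1 - real n * infdist z C)" for n and z :: "complex^2"
  define e where "e n = inverse (real (Suc n))" for n
  have norm_circle: "norm (circle_map x) \<le> 2" for x
  proof -
    have "norm (circle_map x) \<le> (\<Sum>i\<in>UNIV. norm (circle_map x $ i))"
      unfolding norm_vec_def by (rule L2_set_le_sum) simp
    then show ?thesis by (simp add: circle_map_def)
  qed
  \<comment> \<open>The ball of radius 2 is a compact set containing the image of
    \<open>circle_map\<close>; \<open>C\<close> need not contain it.\<close>
  have "\<exists>g. real_polynomial_function g \<and> (\<forall>z\<in>cball 0 2. \<bar>c n z - g z\<bar> < e n)" for n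
  proof -
    have "continuous_on (cball 0 2) (c n)" unfolding c_def by (intro continuous_intros)
    then show ?thesis
      by (rule Stone_Weierstrass_real_polynomial_function[OF compact_cball, where e = "e n"])
        (auto simp: e_def)
  qed
  then obtain g where g: "\<And>n. real_polynomial_function (g n)"
    "\<And>n z. z \<in> cball 0 2 \<Longrightarrow> \<bar>c n z - g n z\<bar> < e n" by metis
  have gc: "\<bar>g n (circle_map x) - c n (circle_map x)\<bar> < e n" for n x
    using g(2)[of "circle_map x" n] norm_circle[of x] by (simp add: abs_minus_commute)
  have clim: "(\<lambda>n. c n z) \<longlonglongrightarrow> indicator C z" for z
  proof (cases "z \<in> C")
    case False
    then have d: "infdist z C > 0"
      using \<open>C \<noteq> {}\<close> assms compact_imp_closed in_closed_iff_infdist_zero infdist_nonneg[of z C]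
      by (metis less_le)
    obtain m where m: "real m * infdist z C > 1" using reals_Archimedean3[OF d] by blast
    have "c n z = 0" if "n \<ge> m" for n
    proof -
      have "real m * infdist z C \<le> real n * infdist z C" using that d by (intro mult_right_mono) auto
      then show ?thesis using m by (simp add: c_def)
    qed
    then have "eventually (\<lambda>n. c n z = 0) sequentially"
      unfolding eventually_sequentially by blast
    then show ?thesis using False by (simp add: tendsto_eventually)
  qed (simp add: c_def)
  have elim: "e \<longlonglongrightarrow> 0" unfolding e_def by (rule LIMSEQ_inverse_real_of_nat)
  show ?thesis
  proof
    show "(\<lambda>x. complex_of_real (g n (circle_map x))) \<in> trig_polys" for n
      by (rule trig_polys_real_polynomial[OF g(1)])
    show "norm (complex_of_real (g n (circle_map x))) \<le> 2" for n x
    proof -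
      have "e n \<le> 1" "0 \<le> c n (circle_map x)" "c n (circle_map x) \<le> 1"
        by (auto simp: e_def c_def field_simps infdist_nonneg)
      then show ?thesis using gc[of n x] by simp
    qed
    show "(\<lambda>n. complex_of_real (g n (circle_map x))) \<longlonglongrightarrow> indicator C (circle_map x)" for x
    proof -
      have "(\<lambda>n. g n (circle_map x) - c n (circle_map x)) \<longlonglongrightarrow> 0"
        using gc[of _ x] by (intro Lim_null_comparison[OF _ elim]) (auto intro: always_eventually less_imp_le)
      from tendsto_add[OF this clim[of "circle_map x"]]
      have "(\<lambda>n. complex_of_real (g n (circle_map x))) \<longlonglongrightarrow> complex_of_real (indicator C (circle_map x))"
        by (simp add: tendsto_of_real)
      moreover have "complex_of_real (indicator C z) = indicator C z" for z
        by (simp add: indicator_def)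
      ultimately show ?thesis by simp
    qed
  qed
qed

text \<open>Character integrals determine the measure: they fix integrals of trigonometric
  polynomials, then masses of compact sets in the embedding by dominated convergence, then of Borel
  sets by inner regularity, and \<open>angle_map\<close> carries the equality back.\<close>

lemma distr_torus_eqI:
  fixes T :: "real^2 \<Rightarrow> real^2"
  assumes [measurable]: "T \<in> borel \<rightarrow>\<^sub>M borel" and T: "\<And>x. x \<in> space torus \<Longrightarrow> T x \<in> space torus"
    and char: "\<And>\<xi>. (LINT x|torus. character \<xi> (T x)) = integral\<^sup>L torus (character \<xi>)"
  shows "distr torus borel T = distr torus borel (\<lambda>x. x)"
proof -
  have int_char: "integrable torus (\<lambda>x. character \<xi> (S x))" if [measurable]: "S \<in> borel \<rightarrow>\<^sub>M borel" for \<xi> S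
    by (intro torus.integrable_const_bound[where B = 1]) auto
  have int_poly: "(LINT x|torus. p (T x)) = integral\<^sup>L torus p" if "p \<in> trig_polys" for p
    using that int_char[of T] int_char[of "\<lambda>x. x"]
    by (elim trig_polysE) (simp add: Bochner_Integration.integral_sum char)
  have compact_eq: "emeasure (distr torus borel (circle_map \<circ> T)) C = emeasure (distr torus borel circle_map) C"
    if C: "compact C" for C
  proof -
    have [measurable]: "C \<in> sets borel" using C by (rule borel_compact)
    obtain p where p: "\<And>n. p n \<in> trig_polys" "\<And>n x. norm (p n x) \<le> 2"
      "\<And>x. (\<lambda>n. p n x) \<longlonglongrightarrow> indicator C (circle_map x)"
      by (rule trig_polys_approx_indicator[OF C]) blast
    have pm[measurable]: "p n \<in> borel_measurable borel" for n
      using p(1) by (rule borel_measurable_trig_polys)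
    have lim: "(\<lambda>n. LINT x|torus. p n (S x)) \<longlonglongrightarrow> (LINT x|torus. indicator C (circle_map (S x)))"
      if [measurable]: "S \<in> borel \<rightarrow>\<^sub>M borel" for S
      by (rule integral_dominated_convergence[where w = "\<lambda>_. 2"]) (use p in auto)
    have "(LINT x|torus. indicator C (circle_map (T x)) :: complex) = (LINT x|torus. indicator C (circle_map x))"
      using lim[of T] lim[of "\<lambda>x. x"] int_poly[OF p(1)] LIMSEQ_unique by auto
    moreover have "(LINT x|torus. indicator C (circle_map (S x)) :: complex)
        = of_real (measure torus ((circle_map \<circ> S) -` C \<inter> space torus))" if [measurable]: "S \<in> borel \<rightarrow>\<^sub>M borel" for S
    proof -
      have "(circle_map \<circ> S) -` C \<inter> space torus \<in> sets torus"
        by (rule measurable_sets[of _ _ borel]) (simp_all add: comp_def)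
      moreover have "(LINT x|torus. indicator C (circle_map (S x)) :: complex)
          = (LINT x|torus. of_real (indicator ((circle_map \<circ> S) -` C \<inter> space torus) x))"
        by (intro Bochner_Integration.integral_cong) (auto simp: indicator_def)
      ultimately show ?thesis by (simp add: integral_complex_of_real)
    qed
    note this[of T] this[of "\<lambda>x. x"]
    ultimately have "measure torus ((circle_map \<circ> T) -` C \<inter> space torus) = measure torus (circle_map -` C \<inter> space torus)"
      by (simp add: comp_def)
    then show ?thesis
      by (simp add: emeasure_distr torus.emeasure_eq_measure)
  qed
  have circle_eq: "distr torus borel (circle_map \<circ> T) = distr torus borel circle_map"
  proof (rule measure_eqI)
    fix B assume B: "B \<in> sets (distr torus borel (circle_map \<circ> T))"
    have fin: "emeasure (distr torus borel S) (space (distr torus borel S)) \<noteq> \<infinity>"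
      if [measurable]: "S \<in> borel \<rightarrow>\<^sub>M borel" for S :: "real^2 \<Rightarrow> complex^2"
      by (simp add: emeasure_distr)
    show "emeasure (distr torus borel (circle_map \<circ> T)) B = emeasure (distr torus borel circle_map) B"
      using B inner_regular[of "distr torus borel (circle_map \<circ> T)" B]
        inner_regular[of "distr torus borel circle_map" B] fin
      by (simp add: compact_eq)
  qed simp
  show ?thesis
  proof (rule measure_eqI)
    fix B assume "B \<in> sets (distr torus borel T)"
    then have [measurable]: "B \<in> sets borel" by simp
    have *: "emeasure (distr torus borel S) B = emeasure (distr torus borel (circle_map \<circ> S)) (angle_map -` B)"
      if [measurable]: "S \<in> borel \<rightarrow>\<^sub>M borel" and S: "\<And>x. x \<in> space torus \<Longrightarrow> S x \<in> space torus" for S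
    proof -
      have [measurable]: "angle_map -` B \<in> sets borel"
        using measurable_sets[OF borel_measurable_angle_map, of B] by simp
      have "S -` B \<inter> space torus = (circle_map \<circ> S) -` (angle_map -` B) \<inter> space torus"
        using S by (auto simp: angle_map_circle_map)
      then show ?thesis by (simp add: emeasure_distr)
    qed
    show "emeasure (distr torus borel T) B = emeasure (distr torus borel (\<lambda>x. x)) B"
      using *[of T] *[of "\<lambda>x. x"] T circle_eq by (simp add: comp_def)
  qed simp
qed

section \<open>Density of trigonometric polynomials\<close>

text \<open>The squared L2 norm, valued in \<open>ennreal\<close> so that estimates can be chained
  before finiteness is known.\<close>

definition l2_sq :: "(real^2 \<Rightarrow> complex) \<Rightarrow> ennreal" where
  "l2_sq g = (\<integral>\<^sup>+x. ennreal ((norm (g x))\<^sup>2) \<partial>torus)"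

lemma l2_sq_cong: "(\<And>x. x \<in> space torus \<Longrightarrow> f x = g x) \<Longrightarrow> l2_sq f = l2_sq g"
  unfolding l2_sq_def by (intro nn_integral_cong) simp

lemma l2_sq_cmult:
  assumes [measurable]: "f \<in> borel_measurable borel"
  shows "l2_sq (\<lambda>x. c * f x) = ennreal ((norm c)\<^sup>2) * l2_sq f"
  unfolding l2_sq_def
  by (subst nn_integral_cmult[symmetric])
    (simp_all add: norm_mult power_mult_distrib flip: ennreal_mult)

lemma l2_sq_sum_le:
  assumes [measurable]: "\<And>i. i \<in> I \<Longrightarrow> f i \<in> borel_measurable borel" and "finite I"
  shows "l2_sq (\<lambda>x. \<Sum>i\<in>I. f i x) \<le> of_nat (card I) * (\<Sum>i\<in>I. l2_sq (f i))"
proof -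
  have "ennreal ((norm (\<Sum>i\<in>I. f i x))\<^sup>2) \<le> of_nat (card I) * (\<Sum>i\<in>I. ennreal ((norm (f i x))\<^sup>2))" for x
  proof -
    have "(norm (\<Sum>i\<in>I. f i x))\<^sup>2 \<le> (\<Sum>i\<in>I. norm (f i x))\<^sup>2"
      by (intro power_mono norm_sum) simp
    also have "\<dots> \<le> (\<Sum>i\<in>I. (norm (f i x))\<^sup>2) * card I"
      by (rule sum_squared_le_sum_of_squares)
    finally have "ennreal ((norm (\<Sum>i\<in>I. f i x))\<^sup>2) \<le> ennreal (real (card I) * (\<Sum>i\<in>I. (norm (f i x))\<^sup>2))"
      by (intro ennreal_leI) (simp add: mult.commute)
    then show ?thesis
      by (simp add: ennreal_mult sum_nonneg ennreal_of_nat_eq_real_of_nat flip: sum_ennreal)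
  qed
  then have "l2_sq (\<lambda>x. \<Sum>i\<in>I. f i x) \<le> (\<integral>\<^sup>+x. of_nat (card I) * (\<Sum>i\<in>I. ennreal ((norm (f i x))\<^sup>2)) \<partial>torus)"
    unfolding l2_sq_def by (intro nn_integral_mono)
  also have "\<dots> = of_nat (card I) * (\<Sum>i\<in>I. l2_sq (f i))"
    unfolding l2_sq_def by (simp add: nn_integral_cmult nn_integral_sum del: sum_ennreal)
  finally show ?thesis .
qed

lemma l2_sq_add_le:
  assumes "f \<in> borel_measurable borel" "g \<in> borel_measurable borel"
  shows "l2_sq (\<lambda>x. f x + g x) \<le> 2 * (l2_sq f + l2_sq g)"
proof -
  have "(\<lambda>x. \<Sum>i\<in>UNIV. (if i then f else g) x) = (\<lambda>x. f x + g x)"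
    by (simp add: UNIV_bool add.commute)
  moreover have "(if i then f else g) \<in> borel_measurable borel" for i
    using assms by simp
  ultimately show ?thesis
    using l2_sq_sum_le[of "UNIV :: bool set" "\<lambda>i. if i then f else g"]
    by (simp add: UNIV_bool add.commute)
qed

lemma l2_sq_tendsto_0:
  assumes [measurable]: "\<And>n. u n \<in> borel_measurable borel" "g \<in> borel_measurable borel"
    "w \<in> borel_measurable borel"
    and bound: "\<And>n x. x \<in> space torus \<Longrightarrow> (norm (g x - u n x))\<^sup>2 \<le> w x"
    and w: "(\<integral>\<^sup>+x. ennreal (w x) \<partial>torus) < \<infinity>"
    and lim: "\<And>x. x \<in> space torus \<Longrightarrow> (\<lambda>n. u n x) \<longlonglongrightarrow> g x"
  shows "(\<lambda>n. l2_sq (\<lambda>x. g x - u n x)) \<longlonglongrightarrow> 0"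
proof -
  have "(\<lambda>n. \<integral>\<^sup>+x. ennreal ((norm (g x - u n x))\<^sup>2) \<partial>torus) \<longlonglongrightarrow> (\<integral>\<^sup>+x. 0 \<partial>torus)"
  proof (rule nn_integral_dominated_convergence[where w = "\<lambda>x. ennreal (w x)"])
    show "AE x in torus. ennreal ((norm (g x - u n x))\<^sup>2) \<le> ennreal (w x)" for n
      using bound by (intro AE_I2 ennreal_leI)
    show "AE x in torus. (\<lambda>n. ennreal ((norm (g x - u n x))\<^sup>2)) \<longlonglongrightarrow> 0"
    proof (rule AE_I2)
      fix x assume "x \<in> space torus"
      then have "(\<lambda>n. (norm (g x - u n x))\<^sup>2) \<longlonglongrightarrow> (norm (g x - g x))\<^sup>2"
        by (intro tendsto_intros lim)
      from tendsto_ennrealI[OF this] show "(\<lambda>n. ennreal ((norm (g x - u n x))\<^sup>2)) \<longlonglongrightarrow> 0"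
        by simp
    qed
  qed (use w in simp_all)
  then show ?thesis by (simp add: l2_sq_def)
qed

lemma tendsto_0_ennreal_witness:
  fixes a :: "nat \<Rightarrow> ennreal"
  assumes "a \<longlonglongrightarrow> 0" "\<epsilon> > 0"
  shows "\<exists>n. a n \<le> ennreal \<epsilon>"
proof -
  have "eventually (\<lambda>n. a n < ennreal \<epsilon>) sequentially"
    using assms by (intro order_tendstoD(2)) auto
  then show ?thesis
    by (metis eventually_sequentially less_imp_le order_refl)
qed

definition trig_approximable :: "(real^2 \<Rightarrow> complex) \<Rightarrow> bool" where
  "trig_approximable g \<longleftrightarrow> (\<forall>\<epsilon>>0. \<exists>p\<in>trig_polys. l2_sq (\<lambda>x. g x - p x) \<le> ennreal \<epsilon>)"

lemma trig_approximable_cong: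
  assumes "\<And>x. x \<in> space torus \<Longrightarrow> f x = g x"
  shows "trig_approximable f \<longleftrightarrow> trig_approximable g"
proof -
  have "l2_sq (\<lambda>x. f x - p x) = l2_sq (\<lambda>x. g x - p x)" for p
    using assms by (intro l2_sq_cong) simp
  then show ?thesis by (simp add: trig_approximable_def)
qed

text \<open>Approximability is closed under L2 limits; the closure steps for sums, multiples, Borel
  sets and monotone limits all pass through this.\<close>

lemma trig_approximable_close:
  assumes [measurable]: "g \<in> borel_measurable borel"
    and close: "\<And>\<epsilon>. \<epsilon> > 0 \<Longrightarrow> \<exists>h. h \<in> borel_measurable borel \<and> trig_approximable h \<and> l2_sq (\<lambda>x. g x - h x) \<le> ennreal \<epsilon>"
  shows "trig_approximable g"
  unfolding trig_approximable_def
proof (intro allI impI)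
  fix \<epsilon> :: real assume "\<epsilon> > 0"
  then have e4: "\<epsilon> / 4 > 0" by simp
  obtain h where [measurable]: "h \<in> borel_measurable borel" and h: "trig_approximable h"
    "l2_sq (\<lambda>x. g x - h x) \<le> ennreal (\<epsilon> / 4)"
    using close[OF e4] by blast
  obtain p where p: "p \<in> trig_polys" "l2_sq (\<lambda>x. h x - p x) \<le> ennreal (\<epsilon> / 4)"
    using h(1) e4 unfolding trig_approximable_def by blast
  have [measurable]: "p \<in> borel_measurable borel" using p(1) by (rule borel_measurable_trig_polys)
  have "l2_sq (\<lambda>x. g x - p x) = l2_sq (\<lambda>x. (g x - h x) + (h x - p x))" by simp
  also have "\<dots> \<le> 2 * (l2_sq (\<lambda>x. g x - h x) + l2_sq (\<lambda>x. h x - p x))"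
    by (intro l2_sq_add_le) simp_all
  also have "\<dots> \<le> 2 * (ennreal (\<epsilon> / 4) + ennreal (\<epsilon> / 4))"
    using h(2) p(2) by (intro mult_left_mono add_mono) auto
  also have "\<dots> = ennreal \<epsilon>"
  proof -
    have "2 * (ennreal (\<epsilon> / 4) + ennreal (\<epsilon> / 4)) = ennreal 2 * ennreal (\<epsilon> / 4 + \<epsilon> / 4)"
      using \<open>\<epsilon> > 0\<close> by (subst ennreal_plus) auto
    also have "\<dots> = ennreal (2 * (\<epsilon> / 4 + \<epsilon> / 4))"
      using \<open>\<epsilon> > 0\<close> by (subst ennreal_mult) auto
    finally show ?thesis by simp
  qed
  finally show "\<exists>p\<in>trig_polys. l2_sq (\<lambda>x. g x - p x) \<le> ennreal \<epsilon>"
    using p(1) by blast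
qed

lemma trig_approximable_trig_polys: "p \<in> trig_polys \<Longrightarrow> trig_approximable p"
  unfolding trig_approximable_def by (intro allI impI bexI[of _ p]) (auto simp: l2_sq_def)

lemma trig_approximable_add:
  assumes [measurable]: "f \<in> borel_measurable borel" "g \<in> borel_measurable borel"
    and "trig_approximable f" "trig_approximable g"
  shows "trig_approximable (\<lambda>x. f x + g x)"
proof (rule trig_approximable_close)
  fix \<epsilon> :: real assume "\<epsilon> > 0"
  then have e4: "\<epsilon> / 4 > 0" by simp
  obtain p where p: "p \<in> trig_polys" "l2_sq (\<lambda>x. f x - p x) \<le> ennreal (\<epsilon> / 4)"
    using assms(3) e4 unfolding trig_approximable_def by blast
  obtain q where q: "q \<in> trig_polys" "l2_sq (\<lambda>x. g x - q x) \<le> ennreal (\<epsilon> / 4)"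
    using assms(4) e4 unfolding trig_approximable_def by blast
  have [measurable]: "p \<in> borel_measurable borel" "q \<in> borel_measurable borel"
    using p(1) q(1) by (simp_all add: borel_measurable_trig_polys)
  have "l2_sq (\<lambda>x. f x + g x - (p x + q x)) = l2_sq (\<lambda>x. (f x - p x) + (g x - q x))"
    by (simp add: algebra_simps)
  also have "\<dots> \<le> 2 * (l2_sq (\<lambda>x. f x - p x) + l2_sq (\<lambda>x. g x - q x))"
    by (intro l2_sq_add_le) simp_all
  also have "\<dots> \<le> 2 * (ennreal (\<epsilon> / 4) + ennreal (\<epsilon> / 4))"
    using q(2) p(2) by (intro mult_left_mono add_mono) auto
  also have "\<dots> = ennreal 2 * ennreal (\<epsilon> / 4 + \<epsilon> / 4)"
    using \<open>\<epsilon> > 0\<close> by (subst ennreal_plus) auto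
  also have "\<dots> = ennreal (2 * (\<epsilon> / 4 + \<epsilon> / 4))"
    using \<open>\<epsilon> > 0\<close> by (subst ennreal_mult) auto
  finally have "l2_sq (\<lambda>x. f x + g x - (p x + q x)) \<le> ennreal \<epsilon>" by simp
  moreover have "trig_approximable (\<lambda>x. p x + q x)"
    using p(1) q(1) by (intro trig_approximable_trig_polys trig_polys_add)
  ultimately show "\<exists>h. h \<in> borel_measurable borel \<and> trig_approximable h \<and> l2_sq (\<lambda>x. f x + g x - h x) \<le> ennreal \<epsilon>"
    by (intro exI[of _ "\<lambda>x. p x + q x"]) simp
qed simp

lemma trig_approximable_cmult:
  assumes [measurable]: "f \<in> borel_measurable borel" and "trig_approximable f"
  shows "trig_approximable (\<lambda>x. c * f x)"
proof (rule trig_approximable_close)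
  fix \<epsilon> :: real assume \<epsilon>: "\<epsilon> > 0"
  define d where "d = (norm c)\<^sup>2 + 1"
  have d: "d > 0" by (simp add: d_def add_nonneg_pos)
  obtain p where p: "p \<in> trig_polys" "l2_sq (\<lambda>x. f x - p x) \<le> ennreal (\<epsilon> / d)"
    using assms(2) \<epsilon> d unfolding trig_approximable_def by (metis divide_pos_pos)
  have [measurable]: "p \<in> borel_measurable borel"
    using p(1) by (rule borel_measurable_trig_polys)
  have "l2_sq (\<lambda>x. c * f x - c * p x) = ennreal ((norm c)\<^sup>2) * l2_sq (\<lambda>x. f x - p x)"
    by (subst l2_sq_cmult[symmetric]) (simp_all add: algebra_simps)
  also have "\<dots> \<le> ennreal d * ennreal (\<epsilon> / d)"
    using p(2) by (intro mult_mono ennreal_leI) (auto simp: d_def)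
  also have "\<dots> = ennreal \<epsilon>"
    using d \<epsilon> by (simp flip: ennreal_mult)
  finally have "l2_sq (\<lambda>x. c * f x - c * p x) \<le> ennreal \<epsilon>" .
  moreover have "trig_approximable (\<lambda>x. c * p x)"
    using p(1) trig_polys_const by (intro trig_approximable_trig_polys trig_polys_mult)
  ultimately show "\<exists>h. h \<in> borel_measurable borel \<and> trig_approximable h \<and> l2_sq (\<lambda>x. c * f x - h x) \<le> ennreal \<epsilon>"
    by (intro exI[of _ "\<lambda>x. c * p x"]) simp
qed simp

text \<open>Compact sets in the embedding are handled by polynomial cutoffs. A Borel set is reached
  from a compact subset that misses mass at most \<open>\<epsilon>\<close>, and \<open>S\<close>
  corresponds to its preimage under \<open>angle_map\<close>.\<close>

lemma trig_approximable_indicator: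
  assumes [measurable]: "S \<in> sets borel"
  shows "trig_approximable (indicator S)"
proof -
  have comp: "trig_approximable (\<lambda>x. indicator C (circle_map x))" if C: "compact C" for C
  proof (rule trig_approximable_close)
    have [measurable]: "C \<in> sets borel" using C by (rule borel_compact)
    show "(\<lambda>x. indicator C (circle_map x) :: complex) \<in> borel_measurable borel" by measurable
    fix \<epsilon> :: real assume "\<epsilon> > 0"
    obtain p where p: "\<And>n. p n \<in> trig_polys" "\<And>n x. norm (p n x) \<le> 2"
      "\<And>x. (\<lambda>n. p n x) \<longlonglongrightarrow> indicator C (circle_map x)"
      by (rule trig_polys_approx_indicator[OF C]) blast
    have pm[measurable]: "p n \<in> borel_measurable borel" for n
      using p(1) by (rule borel_measurable_trig_polys)
    have "(\<lambda>n. l2_sq (\<lambda>x. indicator C (circle_map x) - p n x)) \<longlonglongrightarrow> 0"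
    proof (rule l2_sq_tendsto_0[where w = "\<lambda>_. 9"])
      show "(norm (indicator C (circle_map x) - p n x))\<^sup>2 \<le> 9" for n x
      proof -
        have "norm (indicator C (circle_map x) - p n x) \<le> 1 + 2"
          using p(2)[of n x]
          by (intro order.trans[OF norm_triangle_ineq4] add_mono) (auto simp: indicator_def)
        then have "(norm (indicator C (circle_map x) - p n x))\<^sup>2 \<le> (1 + 2)\<^sup>2"
          by (rule power_mono) simp
        then show ?thesis by simp
      qed
    qed (use p(3) emeasure_torus in simp_all)
    then obtain n where "l2_sq (\<lambda>x. indicator C (circle_map x) - p n x) \<le> ennreal \<epsilon>"
      using tendsto_0_ennreal_witness \<open>\<epsilon> > 0\<close> by blast
    then show "\<exists>h. h \<in> borel_measurable borel \<and> trig_approximable h \<and>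
        l2_sq (\<lambda>x. indicator C (circle_map x) - h x) \<le> ennreal \<epsilon>"
      using pm trig_approximable_trig_polys[OF p(1)] by blast
  qed
  define B where "B = angle_map -` S"
  have [measurable]: "B \<in> sets borel"
    using measurable_sets[OF borel_measurable_angle_map, of S] by (simp add: B_def)
  have approx: "trig_approximable (\<lambda>x. indicator B (circle_map x))"
  proof (rule trig_approximable_close)
    show "(\<lambda>x. indicator B (circle_map x) :: complex) \<in> borel_measurable borel" by measurable
    fix \<epsilon> :: real assume \<epsilon>: "\<epsilon> > 0"
    define \<nu> where "\<nu> = distr torus borel circle_map"
    have fin: "emeasure \<nu> D \<noteq> top" for D
    proof -
      have "emeasure \<nu> D \<le> emeasure \<nu> (space \<nu>)" by (rule emeasure_space)
      also have "\<dots> = 1" by (simp add: \<nu>_def emeasure_distr emeasure_torus)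
      finally show ?thesis by (auto simp: top_unique)
    qed
    have "\<exists>C. C \<subseteq> B \<and> compact C \<and> emeasure \<nu> B \<le> emeasure \<nu> C + ennreal \<epsilon>"
    proof (rule ccontr)
      assume *: "\<not> ?thesis"
      have "emeasure \<nu> B = (SUP C\<in>{C. C \<subseteq> B \<and> compact C}. emeasure \<nu> C)"
        by (rule inner_regular) (use fin in \<open>auto simp: \<nu>_def\<close>)
      then have "emeasure \<nu> B + ennreal \<epsilon> = (SUP C\<in>{C. C \<subseteq> B \<and> compact C}. emeasure \<nu> C + ennreal \<epsilon>)"
        by (subst ennreal_SUP_add_left) (auto intro: exI[of _ "{}"])
      also have "\<dots> \<le> emeasure \<nu> B"
        using * by (intro SUP_least) (auto simp: not_le less_imp_le)
      finally have "emeasure \<nu> B + ennreal \<epsilon> \<le> emeasure \<nu> B + 0" by simp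
      then have "ennreal \<epsilon> \<le> 0"
        using fin[of B] unfolding ennreal_add_left_cancel_le by simp
      then show False using \<epsilon> by (simp add: ennreal_eq_0_iff)
    qed
    then obtain C where C: "C \<subseteq> B" "compact C" "emeasure \<nu> B \<le> emeasure \<nu> C + ennreal \<epsilon>" by blast
    have [measurable]: "C \<in> sets borel" using C(2) by (rule borel_compact)
    have "l2_sq (\<lambda>x. indicator B (circle_map x) - indicator C (circle_map x))
        = (\<integral>\<^sup>+x. indicator (B - C) (circle_map x) \<partial>torus)"
      unfolding l2_sq_def using C(1)
      by (intro nn_integral_cong) (auto simp: indicator_def)
    also have "\<dots> = emeasure \<nu> (B - C)"
      unfolding \<nu>_def
      by (subst nn_integral_indicator[symmetric], simp, subst nn_integral_distr) simp_all
    also have "\<dots> = emeasure \<nu> B - emeasure \<nu> C"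
      using C(1) fin by (intro emeasure_Diff) (auto simp: \<nu>_def)
    also have "\<dots> \<le> ennreal \<epsilon>"
      using C(3) fin[of B] by (simp add: ennreal_minus_le_iff add.commute)
    finally show "\<exists>h. h \<in> borel_measurable borel \<and> trig_approximable h \<and>
        l2_sq (\<lambda>x. indicator B (circle_map x) - h x) \<le> ennreal \<epsilon>"
      using comp[OF C(2)] by (intro exI[of _ "\<lambda>x. indicator C (circle_map x)"]) simp
  qed
  have "indicator B (circle_map x) = (indicator S x :: complex)" if "x \<in> space torus" for x
    using angle_map_circle_map[OF that] by (simp add: B_def indicator_def)
  from trig_approximable_cong[OF this] approx show ?thesis by simp
qed

text \<open>Standard induction over measurable functions: the finite norm of the whole bounds that
  of its parts, and in the limit case the squared error is dominated by the square of
  \<open>u\<close>.\<close>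

lemma trig_approximable_nonneg:
  fixes u :: "real^2 \<Rightarrow> real"
  assumes "u \<in> borel_measurable borel" "\<And>x. 0 \<le> u x" "l2_sq (\<lambda>x. of_real (u x)) < \<infinity>"
  shows "trig_approximable (\<lambda>x. of_real (u x))"
  using assms
proof (induction rule: borel_measurable_induct_real)
  case (set S)
  then show ?case
    using trig_approximable_indicator[of S] by (simp add: of_real_indicator)
next
  case (mult u c)
  have [measurable]: "u \<in> borel_measurable borel" by fact
  show ?case
  proof (cases "c = 0")
    case True
    then show ?thesis using trig_approximable_trig_polys[OF trig_polys_const[of 0]] by simp
  next
    case False
    have "l2_sq (\<lambda>x. of_real (c * u x)) = ennreal ((norm c)\<^sup>2) * l2_sq (\<lambda>x. of_real (u x))"
      using l2_sq_cmult[of "\<lambda>x. complex_of_real (u x)" "of_real c"] by simp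
    with mult.prems False have "l2_sq (\<lambda>x. of_real (u x)) < \<infinity>"
      by (auto simp: ennreal_mult_less_top)
    then have "trig_approximable (\<lambda>x. of_real c * of_real (u x))"
      by (intro trig_approximable_cmult mult.IH) simp
    then show ?thesis by simp
  qed
next
  case (add u v)
  have [measurable]: "u \<in> borel_measurable borel" "v \<in> borel_measurable borel" by fact+
  have "l2_sq (\<lambda>x. of_real (w x)) \<le> l2_sq (\<lambda>x. of_real (v x + u x))"
    if "\<And>x. 0 \<le> w x" "\<And>x. w x \<le> v x + u x" for w
    unfolding l2_sq_def norm_of_real using that
    by (intro nn_integral_mono ennreal_leI power_mono) (auto intro: order_trans[OF _ abs_ge_self])
  from this[of u] this[of v] add.prems add.hyps
  have "l2_sq (\<lambda>x. of_real (u x)) < \<infinity>" "l2_sq (\<lambda>x. of_real (v x)) < \<infinity>"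
    by (auto intro: le_less_trans)
  then have "trig_approximable (\<lambda>x. of_real (v x) + of_real (u x))"
    by (intro trig_approximable_add add.IH) simp_all
  then show ?case by simp
next
  case (seq U)
  have U[measurable]: "U i \<in> borel_measurable borel" for i by fact
  have u[measurable]: "u \<in> borel_measurable borel" by fact
  have le: "U i x \<le> u x" for i x
    using seq.hyps by (intro incseq_le) (auto simp: incseq_def le_fun_def)
  have fin: "(\<integral>\<^sup>+x. ennreal ((u x)\<^sup>2) \<partial>torus) < \<infinity>"
    using seq.prems by (simp add: l2_sq_def)
  show ?case
  proof (rule trig_approximable_close)
    fix \<epsilon> :: real assume \<epsilon>: "\<epsilon> > 0"
    have "(\<lambda>n. l2_sq (\<lambda>x. of_real (u x) - of_real (U n x))) \<longlonglongrightarrow> 0"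
    proof (rule l2_sq_tendsto_0[where w = "\<lambda>x. (u x)\<^sup>2"])
      show "(norm (complex_of_real (u x) - of_real (U n x)))\<^sup>2 \<le> (u x)\<^sup>2" for n x
        using le[of n x] seq.hyps(2)[of n x]
        unfolding of_real_diff[symmetric] norm_of_real by (intro power_mono) auto
      show "(\<lambda>n. complex_of_real (U n x)) \<longlonglongrightarrow> of_real (u x)" for x
        using seq.hyps(4)[of x] by (intro tendsto_of_real) simp
    qed (use fin in simp_all)
    then obtain n where n: "l2_sq (\<lambda>x. of_real (u x) - of_real (U n x)) \<le> ennreal \<epsilon>"
      using tendsto_0_ennreal_witness \<epsilon> by blast
    have "l2_sq (\<lambda>x. of_real (U n x)) \<le> l2_sq (\<lambda>x. of_real (u x))"
      unfolding l2_sq_def norm_of_real using le[of n] seq.hyps(2)[of n]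
      by (intro nn_integral_mono ennreal_leI power_mono) (auto intro: order_trans[OF _ abs_ge_self])
    then have "trig_approximable (\<lambda>x. of_real (U n x))"
      using seq.prems by (intro seq.IH) (auto intro: le_less_trans)
    with n show "\<exists>h. h \<in> borel_measurable borel \<and> trig_approximable h \<and>
        l2_sq (\<lambda>x. of_real (u x) - h x) \<le> ennreal \<epsilon>"
      by (intro exI[of _ "\<lambda>x. of_real (U n x)"]) simp
  qed simp
qed

lemma trig_approximable_L2:
  assumes [measurable]: "g \<in> borel_measurable borel" and fin: "l2_sq g < \<infinity>"
  shows "trig_approximable g"
proof -
  define part where "part u x = complex_of_real (max 0 (u x))" for u :: "real^2 \<Rightarrow> real" and x
  have [measurable (raw)]: "part u \<in> borel_measurable borel" if "u \<in> borel_measurable borel" for u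
    using that unfolding part_def by simp
  have part: "trig_approximable (part u)"
    if [measurable]: "u \<in> borel_measurable borel" and le: "\<And>x. \<bar>u x\<bar> \<le> norm (g x)" for u
  proof -
    have "l2_sq (part u) \<le> l2_sq g"
      unfolding l2_sq_def part_def norm_of_real
    proof (intro nn_integral_mono ennreal_leI power_mono)
      show "\<bar>max 0 (u x)\<bar> \<le> norm (g x)" for x using le[of x] by (auto simp: max_def)
    qed simp
    then have "l2_sq (part u) < \<infinity>" using fin by (rule le_less_trans)
    then show ?thesis
      unfolding part_def by (intro trig_approximable_nonneg) simp_all
  qed
  have "g = (\<lambda>x. (part (\<lambda>x. Re (g x)) x + (-1) * part (\<lambda>x. - Re (g x)) x)
      + (\<i> * part (\<lambda>x. Im (g x)) x + (- \<i>) * part (\<lambda>x. - Im (g x)) x))"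
    by (auto simp: part_def complex_eq_iff max_def fun_eq_iff)
  moreover have "trig_approximable \<dots>"
    using abs_Re_le_cmod abs_Im_le_cmod part[of "\<lambda>x. Re (g x)"] part[of "\<lambda>x. - Re (g x)"]
      part[of "\<lambda>x. Im (g x)"] part[of "\<lambda>x. - Im (g x)"]
    by (intro trig_approximable_add trig_approximable_cmult) simp_all
  ultimately show ?thesis by simp
qed

lemma L2_integrable:
  assumes [measurable]: "g \<in> borel_measurable borel" and "l2_sq g < \<infinity>"
  shows "integrable torus (\<lambda>x. (norm (g x))\<^sup>2)" "integrable torus g"
    "l2_sq g = ennreal (LINT x|torus. (norm (g x))\<^sup>2)"
proof -
  show 1: "integrable torus (\<lambda>x. (norm (g x))\<^sup>2)"
    using assms(2) unfolding l2_sq_def by (intro integrableI_nonneg) auto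
  then show "l2_sq g = ennreal (LINT x|torus. (norm (g x))\<^sup>2)"
    unfolding l2_sq_def by (intro nn_integral_eq_integral) auto
  have "integrable torus (\<lambda>x. 1 + (norm (g x))\<^sup>2)" using 1 by simp
  then show "integrable torus g"
  proof (rule Bochner_Integration.integrable_bound)
    show "AE x in torus. norm (g x) \<le> norm (1 + (norm (g x))\<^sup>2)"
    proof (rule AE_I2)
      fix x
      have "norm (g x) \<le> 1 + (norm (g x))\<^sup>2"
        using zero_le_power2[of "norm (g x) - 1"] norm_ge_zero[of "g x"]
        unfolding power2_diff one_power2 mult_1_right by linarith
      then show "norm (g x) \<le> norm (1 + (norm (g x))\<^sup>2)" by simp
    qed
  qed simp
qed

section \<open>Best approximation by Fourier partial sums\<close>

lemma borel_measurable_cnj [measurable]: "cnj \<in> borel_measurable borel"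
  by (intro borel_measurable_continuous_onI continuous_intros)

lemma integrable_mult_character:
  assumes [measurable]: "g \<in> borel_measurable borel" and "integrable torus g"
  shows "integrable torus (\<lambda>x. g x * cnj (character \<xi> x))"
  by (rule Bochner_Integration.integrable_bound[OF assms(2)]) (auto simp: norm_mult)

text \<open>Pythagoras, by expanding the square with orthonormal characters. Only the last sum
  involves \<open>b\<close>, so Fourier coefficients are optimal on \<open>F\<close>; for
  \<open>g = 0\<close> this is Parseval for polynomials.\<close>

lemma l2_sq_diff_trig_poly:
  assumes [measurable]: "g \<in> borel_measurable borel" and fin: "l2_sq g < \<infinity>" and F: "finite F"
  shows "l2_sq (\<lambda>x. g x - (\<Sum>\<xi>\<in>F. b \<xi> * character \<xi> x))
    = ennreal ((LINT x|torus. (norm (g x))\<^sup>2) - (\<Sum>\<xi>\<in>F. (norm (fourier_coeff g \<xi>))\<^sup>2)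
        + (\<Sum>\<xi>\<in>F. (norm (b \<xi> - fourier_coeff g \<xi>))\<^sup>2))" (is "l2_sq ?d = ennreal ?r")
proof -
  define p where "p x = (\<Sum>\<xi>\<in>F. b \<xi> * character \<xi> x)" for x
  have [measurable]: "p \<in> borel_measurable borel" unfolding p_def by measurable
  have pb: "norm (p x) \<le> (\<Sum>\<xi>\<in>F. norm (b \<xi>))" for x
    unfolding p_def by (intro sum_norm_le) (simp add: norm_mult)
  have p_fin: "l2_sq p < \<infinity>"
  proof -
    have "l2_sq p \<le> (\<integral>\<^sup>+x. ennreal ((\<Sum>\<xi>\<in>F. norm (b \<xi>))\<^sup>2) \<partial>torus)"
      unfolding l2_sq_def using pb by (intro nn_integral_mono ennreal_leI power_mono) auto
    also have "\<dots> < \<infinity>" using emeasure_torus by simp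
    finally show ?thesis .
  qed
  have d_fin: "l2_sq (\<lambda>x. g x - p x) < \<infinity>"
  proof -
    have "l2_sq (\<lambda>x. g x + (-1) * p x) \<le> 2 * (l2_sq g + l2_sq (\<lambda>x. (-1) * p x))"
      by (intro l2_sq_add_le) simp_all
    also have "\<dots> < \<infinity>"
      using fin p_fin l2_sq_cmult[of p "-1"] by (simp add: ennreal_mult_less_top)
    finally show ?thesis by simp
  qed
  note g_int = L2_integrable(2)[OF assms(1) fin]
  have ge: "integrable torus (\<lambda>x. g x * cnj (character \<xi> x))" for \<xi>
    by (rule integrable_mult_character[OF assms(1) g_int])
  have ge': "integrable torus (\<lambda>x. cnj (g x) * character \<xi> x)" for \<xi>
    using integrable_cnj[OF ge[of \<xi>]] by simp
  have ee: "integrable torus (\<lambda>x. character \<xi> x * cnj (character \<zeta> x))" for \<xi> \<zeta>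
    by (intro torus.integrable_const_bound[where B = 1]) (auto simp: norm_mult)
  have cross: "(LINT x|torus. g x * cnj (p x)) = (\<Sum>\<xi>\<in>F. cnj (b \<xi>) * fourier_coeff g \<xi>)"
    "integrable torus (\<lambda>x. g x * cnj (p x))"
  proof -
    have eq: "g x * cnj (p x) = (\<Sum>\<xi>\<in>F. cnj (b \<xi>) * (g x * cnj (character \<xi> x)))" for x
      by (simp add: p_def sum_distrib_left mult_ac)
    show "(LINT x|torus. g x * cnj (p x)) = (\<Sum>\<xi>\<in>F. cnj (b \<xi>) * fourier_coeff g \<xi>)"
      unfolding eq fourier_coeff_character using ge by (subst Bochner_Integration.integral_sum) auto
    show "integrable torus (\<lambda>x. g x * cnj (p x))"
      unfolding eq using ge by (intro Bochner_Integration.integrable_sum integrable_mult_right) auto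
  qed
  have cross': "(LINT x|torus. p x * cnj (g x)) = (\<Sum>\<xi>\<in>F. b \<xi> * cnj (fourier_coeff g \<xi>))"
    "integrable torus (\<lambda>x. p x * cnj (g x))"
  proof -
    have eq: "p x * cnj (g x) = cnj (g x * cnj (p x))" for x by simp
    show "(LINT x|torus. p x * cnj (g x)) = (\<Sum>\<xi>\<in>F. b \<xi> * cnj (fourier_coeff g \<xi>))"
      unfolding eq by (subst Bochner_Integration.integral_cnj) (simp add: cross)
    show "integrable torus (\<lambda>x. p x * cnj (g x))"
      unfolding eq by (rule integrable_cnj[OF cross(2)])
  qed
  have self: "(LINT x|torus. p x * cnj (p x)) = (\<Sum>\<xi>\<in>F. b \<xi> * cnj (b \<xi>))"
    "integrable torus (\<lambda>x. p x * cnj (p x))"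
  proof -
    have eq: "p x * cnj (p x) = (\<Sum>\<xi>\<in>F. \<Sum>\<zeta>\<in>F. (b \<xi> * cnj (b \<zeta>)) * (character \<xi> x * cnj (character \<zeta> x)))" for x
      unfolding p_def cnj_sum sum_product by (simp add: mult_ac)
    have orth: "(LINT x|torus. character \<xi> x * cnj (character \<zeta> x)) = (if \<xi> = \<zeta> then 1 else 0)" for \<xi> \<zeta>
      unfolding cnj_character character_add[symmetric] using integral_character[of "\<xi> + - \<zeta>"] by simp
    show "(LINT x|torus. p x * cnj (p x)) = (\<Sum>\<xi>\<in>F. b \<xi> * cnj (b \<xi>))"
      unfolding eq using ee F
      by (subst Bochner_Integration.integral_sum | simp add: orth Bochner_Integration.integral_sum if_distrib cong: if_cong)+
    show "integrable torus (\<lambda>x. p x * cnj (p x))"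
      unfolding eq using ee by (intro Bochner_Integration.integrable_sum integrable_mult_right) auto
  qed
  have gg: "(LINT x|torus. g x * cnj (g x)) = of_real (LINT x|torus. (norm (g x))\<^sup>2)"
    "integrable torus (\<lambda>x. g x * cnj (g x))"
    using L2_integrable(1)[OF assms(1) fin]
    by (simp_all add: complex_norm_square[symmetric] integral_complex_of_real flip: of_real_power)
  have "complex_of_real (LINT x|torus. (norm (g x - p x))\<^sup>2) = (LINT x|torus. (g x - p x) * cnj (g x - p x))"
    by (simp only: complex_norm_square[symmetric] integral_complex_of_real)
  also have "\<dots> = (LINT x|torus. g x * cnj (g x) - g x * cnj (p x) - (p x * cnj (g x) - p x * cnj (p x)))"
    by (simp add: algebra_simps)
  also have "\<dots> = of_real (LINT x|torus. (norm (g x))\<^sup>2) - (\<Sum>\<xi>\<in>F. cnj (b \<xi>) * fourier_coeff g \<xi>)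
      - ((\<Sum>\<xi>\<in>F. b \<xi> * cnj (fourier_coeff g \<xi>)) - (\<Sum>\<xi>\<in>F. b \<xi> * cnj (b \<xi>)))"
    using gg cross cross' self by (simp add: Bochner_Integration.integral_diff)
  also have "\<dots> = of_real ?r"
    unfolding of_real_add of_real_diff of_real_sum of_real_power[symmetric] complex_norm_square
    by (simp add: algebra_simps sum.distrib sum_subtractf complex_norm_square flip: of_real_power)
  finally have "(LINT x|torus. (norm (g x - p x))\<^sup>2) = ?r"
    by (simp only: of_real_eq_iff)
  moreover have "?d = (\<lambda>x. g x - p x)" by (simp add: p_def fun_eq_iff)
  ultimately show ?thesis using L2_integrable(3)[OF _ d_fin] by simp
qed

lemma l2_sq_trig_poly:
  assumes "finite F"
  shows "l2_sq (\<lambda>x. \<Sum>\<xi>\<in>F. b \<xi> * character \<xi> x) = ennreal (\<Sum>\<xi>\<in>F. (norm (b \<xi>))\<^sup>2)"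
proof -
  have "l2_sq (\<lambda>x. 0 - (\<Sum>\<xi>\<in>F. b \<xi> * character \<xi> x)) = ennreal (\<Sum>\<xi>\<in>F. (norm (b \<xi>))\<^sup>2)"
    by (subst l2_sq_diff_trig_poly) (simp_all add: assms fourier_coeff_def l2_sq_def)
  then show ?thesis by (simp add: l2_sq_def)
qed

text \<open>On the frequencies of an approximating polynomial the Fourier partial sum does at least
  as well, so density passes to partial sums.\<close>

lemma fourier_partial_sum_approx:
  assumes "g \<in> borel_measurable borel" and fin: "l2_sq g < \<infinity>" and "\<epsilon> > 0"
  obtains F where "finite F"
    "l2_sq (\<lambda>x. g x - (\<Sum>\<xi>\<in>F. fourier_coeff g \<xi> * character \<xi> x)) \<le> ennreal \<epsilon>"
proof -
  obtain p where p: "p \<in> trig_polys" "l2_sq (\<lambda>x. g x - p x) \<le> ennreal \<epsilon>"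
    using trig_approximable_L2[OF assms(1,2)] \<open>\<epsilon> > 0\<close> unfolding trig_approximable_def by blast
  obtain F b where F: "finite F" "p = (\<lambda>x. \<Sum>\<xi>\<in>F. b \<xi> * character \<xi> x)"
    using p(1) by (rule trig_polysE)
  have "l2_sq (\<lambda>x. g x - (\<Sum>\<xi>\<in>F. fourier_coeff g \<xi> * character \<xi> x)) \<le> l2_sq (\<lambda>x. g x - p x)"
    unfolding F(2) l2_sq_diff_trig_poly[OF assms(1) fin F(1)]
    by (intro ennreal_leI) (simp add: sum_nonneg)
  with p(2) show ?thesis using that[OF F(1)] by simp
qed

section \<open>Variance of Birkhoff sums\<close>

lemma inj_matrix_vector_mult:
  fixes B :: "int^2^2"
  assumes "det B \<noteq> 0"
  shows "inj ((*v) B)"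
proof (rule injI)
  fix \<xi> \<zeta> assume "B *v \<xi> = B *v \<zeta>"
  then have "B *v (\<xi> - \<zeta>) = 0" by (simp add: matrix_vector_mult_diff_distrib)
  then show "\<xi> = \<zeta>" using iterate_nonzero[OF assms, of "\<xi> - \<zeta>" 1] by auto
qed

text \<open>Take the pair \<open>(m, \<eta>)\<close> in \<open>J\<close> with the largest time. By
  injectivity of \<open>B\<close> every other \<open>\<xi>\<close> is a forward iterate of
  \<open>\<eta>\<close>, so the sum over preimages of \<open>\<zeta>\<close> is part of one forward
  orbit sum.\<close>

lemma orbit_preimage_weight_sum:
  assumes det: "det B \<noteq> 0" and "C \<ge> 0"
    and C: "\<And>\<xi> m. \<xi> \<noteq> 0 \<Longrightarrow> (\<Sum>i\<le>m. 1 / log_weight \<delta> (((*v) B ^^ i) \<xi>)) \<le> C"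
    and J: "finite J" "\<And>n \<xi>. (n, \<xi>) \<in> J \<Longrightarrow> \<xi> \<noteq> 0 \<and> ((*v) B ^^ n) \<xi> = \<zeta>"
  shows "(\<Sum>(n, \<xi>)\<in>J. 1 / log_weight \<delta> \<xi>) \<le> C"
proof (cases "J = {}")
  case True
  then show ?thesis using \<open>C \<ge> 0\<close> by simp
next
  case False
  define m where "m = Max (fst ` J)"
  have "m \<in> fst ` J" unfolding m_def using J(1) False by (intro Max_in) auto
  then obtain \<eta> where \<eta>: "(m, \<eta>) \<in> J" by auto
  have le: "n \<le> m" if "(n, \<xi>) \<in> J" for n \<xi>
    unfolding m_def using J(1) that by (intro Max_ge) force+
  have eq: "\<xi> = ((*v) B ^^ (m - n)) \<eta>" if "(n, \<xi>) \<in> J" for n \<xi>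
  proof (rule injD[OF inj_fn[OF inj_matrix_vector_mult[OF det], of n]])
    have "((*v) B ^^ n) (((*v) B ^^ (m - n)) \<eta>) = ((*v) B ^^ m) \<eta>"
      using le[OF that] by (simp flip: funpow_add[THEN fun_cong, unfolded comp_def])
    then show "((*v) B ^^ n) \<xi> = ((*v) B ^^ n) (((*v) B ^^ (m - n)) \<eta>)"
      using J(2)[OF that] J(2)[OF \<eta>] by simp
  qed
  define h where "h i = 1 / log_weight \<delta> (((*v) B ^^ i) \<eta>)" for i
  have "(\<Sum>(n, \<xi>)\<in>J. 1 / log_weight \<delta> \<xi>) = (\<Sum>j\<in>J. h (m - fst j))"
    using eq by (intro sum.cong) (auto simp: h_def)
  also have "\<dots> = sum h ((\<lambda>j. m - fst j) ` J)"
  proof (subst sum.reindex)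
    show "inj_on (\<lambda>j. m - fst j) J"
    proof (rule inj_onI)
      fix j k assume jk: "j \<in> J" "k \<in> J" "m - fst j = m - fst k"
      obtain n \<xi> n' \<xi>' where p: "j = (n, \<xi>)" "k = (n', \<xi>')" by (metis surj_pair)
      have "n = n'" using jk le[of n \<xi>] le[of n' \<xi>'] p by auto
      then show "j = k" using eq[of n \<xi>] eq[of n' \<xi>'] jk p by auto
    qed
  qed simp
  also have "\<dots> \<le> sum h {..m}"
    using log_weight_pos[OF iterate_nonzero[OF det], of \<eta> \<delta>] J(2)[OF \<eta>]
    by (intro sum_mono2) (auto simp: h_def less_imp_le)
  also have "\<dots> \<le> C"
    unfolding h_def using J(2)[OF \<eta>] by (intro C) simp
  finally show ?thesis .
qed

lemma weighted_Cauchy_Schwarz: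
  assumes "\<And>j. j \<in> J \<Longrightarrow> w j > (0::real)"
  shows "(norm (\<Sum>j\<in>J. c j :: complex))\<^sup>2 \<le> (\<Sum>j\<in>J. w j * (norm (c j))\<^sup>2) * (\<Sum>j\<in>J. 1 / w j)"
proof -
  have "(norm (\<Sum>j\<in>J. c j))\<^sup>2 \<le> (\<Sum>j\<in>J. norm (c j))\<^sup>2"
    by (intro power_mono norm_sum) simp
  also have "(\<Sum>j\<in>J. norm (c j)) = (\<Sum>j\<in>J. (sqrt (w j) * norm (c j)) * (1 / sqrt (w j)))"
  proof (intro sum.cong refl)
    show "norm (c j) = (sqrt (w j) * norm (c j)) * (1 / sqrt (w j))" if "j \<in> J" for j
      using assms[OF that] by simp
  qed
  also have "\<dots>\<^sup>2 \<le> (\<Sum>j\<in>J. (sqrt (w j) * norm (c j))\<^sup>2) * (\<Sum>j\<in>J. (1 / sqrt (w j))\<^sup>2)"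
    by (rule Cauchy_Schwarz_ineq_sum)
  also have "(\<Sum>j\<in>J. (sqrt (w j) * norm (c j))\<^sup>2) = (\<Sum>j\<in>J. w j * (norm (c j))\<^sup>2)"
    using assms by (intro sum.cong refl) (simp add: power_mult_distrib less_imp_le)
  also have "(\<Sum>j\<in>J. (1 / sqrt (w j))\<^sup>2) = (\<Sum>j\<in>J. 1 / w j)"
    using assms by (intro sum.cong refl) (simp add: power_divide less_imp_le)
  finally show ?thesis .
qed

lemma char_poly_2_transpose: "char_poly_2 (transpose B) = char_poly_2 B"
  by (simp add: char_poly_2_def fun_eq_iff trace_2 det_2 transpose_def mult.commute)

lemma torus_map_iterate_in_torus: "x \<in> space torus \<Longrightarrow> (torus_map A ^^ n) x \<in> space torus"
  by (cases n) (simp_all add: torus_map_in_torus)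

text \<open>As \<open>det A \<noteq> 0\<close>, the transpose keeps nonzero frequencies nonzero, so
  composition changes no character integral.\<close>

lemma distr_torus_map_iterate:
  assumes "det A \<noteq> 0"
  shows "distr torus borel (torus_map A ^^ n) = distr torus borel (\<lambda>x. x)"
proof (rule distr_torus_eqI)
  fix \<xi>
  have "((*v) (transpose A) ^^ n) \<xi> = 0 \<longleftrightarrow> \<xi> = 0"
  proof
    assume "((*v) (transpose A) ^^ n) \<xi> = 0"
    then show "\<xi> = 0" using iterate_nonzero[of "transpose A" \<xi> n] assms by (auto simp: det_transpose)
  next
    assume "\<xi> = 0"
    then show "((*v) (transpose A) ^^ n) \<xi> = 0" by (induction n) simp_all
  qed
  then show "(LINT x|torus. character \<xi> ((torus_map A ^^ n) x)) = integral\<^sup>L torus (character \<xi>)"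
    by (simp only: character_torus_map_iterate integral_character)
qed (simp_all add: torus_map_iterate_in_torus)

lemma l2_sq_torus_map_iterate:
  assumes "det A \<noteq> 0" and [measurable]: "h \<in> borel_measurable borel"
  shows "l2_sq (\<lambda>x. h ((torus_map A ^^ n) x)) = l2_sq h"
proof -
  have "l2_sq (\<lambda>x. h (S x)) = (\<integral>\<^sup>+x. ennreal ((norm (h x))\<^sup>2) \<partial>distr torus borel S)"
    if [measurable]: "S \<in> borel \<rightarrow>\<^sub>M borel" for S
    unfolding l2_sq_def by (subst nn_integral_distr) simp_all
  from this[of "torus_map A ^^ n"] this[of "\<lambda>x. x"] show ?thesis
    by (simp add: distr_torus_map_iterate[OF assms(1)])
qed

text \<open>Pairs \<open>(n, \<xi>)\<close> are sorted by the frequency reached at time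
  \<open>n\<close>. In each fibre weighted Cauchy-Schwarz costs the inverse weight sum, at most
  \<open>C\<close>; the fibres partition the pairs, so each \<open>\<xi>\<close> is counted
  \<open>N\<close> times in the end.\<close>

lemma l2_sq_birkhoff_sum_trig_poly:
  assumes det: "det A \<noteq> 0" and "C \<ge> 0"
    and C: "\<And>\<xi> m. \<xi> \<noteq> 0 \<Longrightarrow> (\<Sum>i\<le>m. 1 / log_weight \<delta> (((*v) (transpose A) ^^ i) \<xi>)) \<le> C"
    and F: "finite F" "0 \<notin> F"
  shows "l2_sq (\<lambda>x. \<Sum>n<N. \<Sum>\<xi>\<in>F. c \<xi> * character \<xi> ((torus_map A ^^ n) x))
    \<le> ennreal (C * (real N * (\<Sum>\<xi>\<in>F. log_weight \<delta> \<xi> * (norm (c \<xi>))\<^sup>2)))"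
proof -
  define I where "I = {..<N} \<times> F"
  have I: "finite I" using F by (simp add: I_def)
  define k where "k i = ((*v) (transpose A) ^^ fst i) (snd i)" for i :: "nat \<times> (int^2)"
  define J where "J \<zeta> = {i\<in>I. k i = \<zeta>}" for \<zeta>
  define v where "v i = log_weight \<delta> (snd i) * (norm (c (snd i)))\<^sup>2" for i :: "nat \<times> (int^2)"
  have "(\<lambda>x. \<Sum>n<N. \<Sum>\<xi>\<in>F. c \<xi> * character \<xi> ((torus_map A ^^ n) x))
      = (\<lambda>x. \<Sum>i\<in>I. c (snd i) * character (k i) x)"
    by (simp add: character_torus_map_iterate I_def k_def sum.cartesian_product split_beta)
  also have "\<dots> = (\<lambda>x. \<Sum>\<zeta>\<in>k ` I. (\<Sum>i\<in>J \<zeta>. c (snd i)) * character \<zeta> x)"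
    unfolding J_def by (intro ext sum_characters_collect I)
  finally have "l2_sq (\<lambda>x. \<Sum>n<N. \<Sum>\<xi>\<in>F. c \<xi> * character \<xi> ((torus_map A ^^ n) x))
      = ennreal (\<Sum>\<zeta>\<in>k ` I. (norm (\<Sum>i\<in>J \<zeta>. c (snd i)))\<^sup>2)"
    using I by (simp add: l2_sq_trig_poly)
  also have "\<dots> \<le> ennreal (\<Sum>\<zeta>\<in>k ` I. (\<Sum>i\<in>J \<zeta>. v i) * C)"
  proof (intro ennreal_leI sum_mono)
    fix \<zeta>
    have nz: "snd i \<noteq> 0" if "i \<in> J \<zeta>" for i
      using that F(2) by (auto simp: J_def I_def)
    have "(norm (\<Sum>i\<in>J \<zeta>. c (snd i)))\<^sup>2
        \<le> (\<Sum>i\<in>J \<zeta>. log_weight \<delta> (snd i) * (norm (c (snd i)))\<^sup>2) * (\<Sum>i\<in>J \<zeta>. 1 / log_weight \<delta> (snd i))"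
      by (intro weighted_Cauchy_Schwarz log_weight_pos nz)
    also have "\<dots> \<le> (\<Sum>i\<in>J \<zeta>. v i) * C"
      unfolding v_def
    proof (intro mult_left_mono sum_nonneg mult_nonneg_nonneg)
      have "(\<Sum>(n, \<xi>)\<in>J \<zeta>. 1 / log_weight \<delta> \<xi>) \<le> C"
      proof (rule orbit_preimage_weight_sum[OF _ \<open>C \<ge> 0\<close> C])
        show "det (transpose A) \<noteq> 0" using det by (simp add: det_transpose)
        show "finite (J \<zeta>)" using I by (simp add: J_def)
        show "\<xi> \<noteq> 0 \<and> ((*v) (transpose A) ^^ n) \<xi> = \<zeta>" if "(n, \<xi>) \<in> J \<zeta>" for n \<xi>
          using nz[OF that] that by (simp add: J_def k_def)
      qed
      then show "(\<Sum>i\<in>J \<zeta>. 1 / log_weight \<delta> (snd i)) \<le> C" by (simp add: split_beta)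
    qed (simp_all add: log_weight_def)
    finally show "(norm (\<Sum>i\<in>J \<zeta>. c (snd i)))\<^sup>2 \<le> (\<Sum>i\<in>J \<zeta>. v i) * C" .
  qed
  also have "(\<Sum>\<zeta>\<in>k ` I. (\<Sum>i\<in>J \<zeta>. v i) * C) = C * (\<Sum>\<zeta>\<in>k ` I. \<Sum>i\<in>J \<zeta>. v i)"
    by (simp add: sum_distrib_left sum_distrib_right mult.commute)
  also have "(\<Sum>\<zeta>\<in>k ` I. \<Sum>i\<in>J \<zeta>. v i) = (\<Sum>i\<in>I. v i)"
    unfolding J_def by (rule sum.image_gen[OF I, symmetric])
  also have "\<dots> = (\<Sum>n<N. \<Sum>\<xi>\<in>F. log_weight \<delta> \<xi> * (norm (c \<xi>))\<^sup>2)"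
    unfolding I_def v_def by (subst sum.cartesian_product) (auto intro!: sum.cong)
  also have "\<dots> = real N * (\<Sum>\<xi>\<in>F. log_weight \<delta> \<xi> * (norm (c \<xi>))\<^sup>2)" by simp
  finally show ?thesis .
qed

lemma l2_sq_birkhoff_sum_le:
  assumes det: "det A \<noteq> 0" and nr: "\<And>z. root_of_unity z \<Longrightarrow> char_poly_2 A z \<noteq> 0" and "\<delta> > 0"
    and [measurable]: "g \<in> borel_measurable borel" and fin: "l2_sq g < \<infinity>"
    and mean: "fourier_coeff g 0 = 0"
    and sum: "(\<lambda>\<xi>. log_weight \<delta> \<xi> * (norm (fourier_coeff g \<xi>))\<^sup>2) summable_on UNIV"
  shows "\<exists>K. \<forall>N. l2_sq (\<lambda>x. \<Sum>n<N. g ((torus_map A ^^ n) x)) \<le> ennreal (K * real N)"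
proof -
  define c where "c = fourier_coeff g"
  obtain C0 where C0: "\<And>\<xi> m. \<xi> \<noteq> 0 \<Longrightarrow> (\<Sum>i\<le>m. 1 / log_weight \<delta> (((*v) (transpose A) ^^ i) \<xi>)) \<le> C0"
    using orbit_weight_sum_bounded[of "transpose A" \<delta>] det nr \<open>\<delta> > 0\<close>
    unfolding det_transpose char_poly_2_transpose by blast
  define C where "C = max 0 C0"
  have C: "C \<ge> 0" "\<And>\<xi> m. \<xi> \<noteq> 0 \<Longrightarrow> (\<Sum>i\<le>m. 1 / log_weight \<delta> (((*v) (transpose A) ^^ i) \<xi>)) \<le> C"
    using C0 by (simp_all add: C_def le_max_iff_disj)
  define W where "W = (\<Sum>\<^sub>\<infinity>\<xi>. log_weight \<delta> \<xi> * (norm (c \<xi>))\<^sup>2)"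
  have W: "(\<Sum>\<xi>\<in>F. log_weight \<delta> \<xi> * (norm (c \<xi>))\<^sup>2) \<le> W" if "finite F" for F
    unfolding W_def c_def using sum that by (intro finite_sum_le_infsum) (auto simp: log_weight_def)
  have W0: "W \<ge> 0" using W[of "{}"] by simp
  have "l2_sq (\<lambda>x. \<Sum>n<N. g ((torus_map A ^^ n) x)) \<le> ennreal ((2 * C * W + 2) * real N)" for N
  proof (cases "N = 0")
    case True
    then show ?thesis by (simp add: l2_sq_def)
  next
    case False
    then have N: "1 / real N > 0" by simp
    \<comment> \<open>The tolerance depends on \<open>N\<close>: the crude bound for a sum of
      \<open>N\<close> terms loses \<open>N\<close> squared, which 1/N brings back to
      \<open>N\<close>.\<close>
    obtain F' where F': "finite F'" "l2_sq (\<lambda>x. g x - (\<Sum>\<xi>\<in>F'. c \<xi> * character \<xi> x)) \<le> ennreal (1 / real N)"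
      using fourier_partial_sum_approx[OF assms(4) fin N] unfolding c_def by blast
    \<comment> \<open>The weight vanishes at frequency 0 and could not be inverted there; the zero
      mean lets this term be dropped.\<close>
    define F where "F = F' - {0}"
    have F: "finite F" "0 \<notin> F" using F' by (simp_all add: F_def)
    define p where "p x = (\<Sum>\<xi>\<in>F. c \<xi> * character \<xi> x)" for x
    have [measurable]: "p \<in> borel_measurable borel" unfolding p_def by measurable
    have p_eq: "(\<Sum>\<xi>\<in>F'. c \<xi> * character \<xi> x) = p x" for x
      unfolding p_def using F' mean by (intro sum.mono_neutral_right) (auto simp: F_def c_def)
    define d where "d x = g x - p x" for x
    have [measurable]: "d \<in> borel_measurable borel" unfolding d_def by measurable
    have d: "l2_sq d \<le> ennreal (1 / real N)" using F'(2) by (simp add: p_eq d_def[abs_def])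
    have "l2_sq (\<lambda>x. \<Sum>n<N. d ((torus_map A ^^ n) x))
        \<le> of_nat (card {..<N}) * (\<Sum>n<N. l2_sq (\<lambda>x. d ((torus_map A ^^ n) x)))"
      by (intro l2_sq_sum_le) simp_all
    also have "\<dots> = ennreal (real N) * (ennreal (real N) * l2_sq d)"
      by (simp add: l2_sq_torus_map_iterate[OF det] ennreal_of_nat_eq_real_of_nat)
    also have "\<dots> \<le> ennreal (real N) * (ennreal (real N) * ennreal (1 / real N))"
      using d by (intro mult_left_mono) simp_all
    also have "\<dots> = ennreal (real N)" using False by (simp flip: ennreal_mult)
    finally have d_le: "l2_sq (\<lambda>x. \<Sum>n<N. d ((torus_map A ^^ n) x)) \<le> ennreal (real N)" .
    have "l2_sq (\<lambda>x. \<Sum>n<N. p ((torus_map A ^^ n) x))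
        \<le> ennreal (C * (real N * (\<Sum>\<xi>\<in>F. log_weight \<delta> \<xi> * (norm (c \<xi>))\<^sup>2)))"
      unfolding p_def by (rule l2_sq_birkhoff_sum_trig_poly[OF det C F])
    also have "\<dots> \<le> ennreal (C * (real N * W))"
      using C(1) W[OF F(1)] by (intro ennreal_leI mult_left_mono) simp_all
    finally have p_le: "l2_sq (\<lambda>x. \<Sum>n<N. p ((torus_map A ^^ n) x)) \<le> ennreal (C * (real N * W))" .
    have "l2_sq (\<lambda>x. \<Sum>n<N. g ((torus_map A ^^ n) x))
        = l2_sq (\<lambda>x. (\<Sum>n<N. p ((torus_map A ^^ n) x)) + (\<Sum>n<N. d ((torus_map A ^^ n) x)))"
      by (simp add: d_def flip: sum.distrib)
    also have "\<dots> \<le> 2 * (l2_sq (\<lambda>x. \<Sum>n<N. p ((torus_map A ^^ n) x)) + l2_sq (\<lambda>x. \<Sum>n<N. d ((torus_map A ^^ n) x)))"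
      by (intro l2_sq_add_le) simp_all
    also have "\<dots> \<le> ennreal 2 * (ennreal (C * (real N * W)) + ennreal (real N))"
      using p_le d_le by (intro mult_mono add_mono) simp_all
    also have "\<dots> = ennreal (2 * (C * (real N * W) + real N))"
      using C(1) W0 by (simp only: ennreal_plus ennreal_mult mult_nonneg_nonneg add_nonneg_nonneg of_nat_0_le_iff zero_le_numeral)
    also have "2 * (C * (real N * W) + real N) = (2 * C * W + 2) * real N" by (simp add: algebra_simps)
    finally show ?thesis .
  qed
  then show ?thesis by blast
qed

section \<open>From variance to almost everywhere rates\<close>

definition dyadic_block :: "(nat \<Rightarrow> complex) \<Rightarrow> nat \<Rightarrow> nat \<Rightarrow> complex" where
  "dyadic_block a j i = (\<Sum>l<2 ^ j. a (i * 2 ^ j + l))"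

text \<open>The leading \<open>k\<close> is the Cauchy-Schwarz cost of adding one block from each of
  the \<open>k\<close> scales that occur in partial sums of fewer than \<open>2 ^ k\<close>
  terms.\<close>

definition dyadic_energy :: "(nat \<Rightarrow> complex) \<Rightarrow> nat \<Rightarrow> real" where
  "dyadic_energy a k = real k * (\<Sum>j<k. \<Sum>i<2 ^ (k - j). (norm (dyadic_block a j i))\<^sup>2)"

lemma dyadic_energy_nonneg: "dyadic_energy a k \<ge> 0"
  by (simp add: dyadic_energy_def sum_nonneg)

lemma sum_lessThan_split:
  fixes a :: "nat \<Rightarrow> 'a::comm_monoid_add"
  shows "(\<Sum>l<s + m. a l) = (\<Sum>l<s. a l) + (\<Sum>l<m. a (s + l))"
  by (induction m) (simp_all add: add.assoc)

text \<open>Rademacher--Menshov: \<open>{..<n}\<close> is a disjoint union of dyadic blocks, at most one of each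
  size \<open>2 ^ j\<close>, given by the binary digits of \<open>n\<close>.\<close>

lemma partial_sum_le_dyadic_energy:
  assumes "n < 2 ^ k"
  shows "(norm (\<Sum>l<n. a l))\<^sup>2 \<le> dyadic_energy a k"
proof -
  \<comment> \<open>\<open>P j\<close> sums up to \<open>n\<close> with its last \<open>j\<close>
    binary digits cleared: \<open>P 0\<close> is the full sum and \<open>P k\<close> is
    empty.\<close>
  define P where "P j = (\<Sum>l<(n div 2 ^ j) * 2 ^ j. a l)" for j
  have piece: "(norm (P j - P (Suc j)))\<^sup>2 \<le> (\<Sum>i<2 ^ (k - j). (norm (dyadic_block a j i))\<^sup>2)" if "j < k" for j
  proof -
    define q where "q = n div 2 ^ Suc j"
    \<comment> \<open>The alternative is the binary digit of \<open>n\<close> at place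
      \<open>j\<close>; a digit 1 adds the single block of index \<open>2 * q\<close>.\<close>
    have "n div 2 ^ j = 2 * q \<or> n div 2 ^ j = 2 * q + 1"
      unfolding q_def power_Suc2 div_mult2_eq by linarith
    then show ?thesis
    proof
      assume "n div 2 ^ j = 2 * q"
      then have "P j = P (Suc j)"
        unfolding P_def q_def[symmetric] by (simp add: mult_ac)
      then show ?thesis by (simp add: sum_nonneg)
    next
      assume q1: "n div 2 ^ j = 2 * q + 1"
      have e: "q * 2 ^ Suc j = 2 * q * 2 ^ j" "(2 * q + 1) * 2 ^ j = 2 * q * 2 ^ j + 2 ^ j"
        by simp_all
      have "P j = P (Suc j) + dyadic_block a j (2 * q)"
        unfolding P_def q1 q_def[symmetric] dyadic_block_def e by (rule sum_lessThan_split)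
      then have eq: "P j - P (Suc j) = dyadic_block a j (2 * q)" by simp
      have "n < 2 ^ (k - j) * 2 ^ j" using assms that by (simp flip: power_add)
      then have "n div 2 ^ j < 2 ^ (k - j)" by (simp add: less_mult_imp_div_less)
      then have "2 * q \<in> {..<2 ^ (k - j)}" using q1 by simp
      then show ?thesis unfolding eq
        by (intro member_le_sum[of "2 * q" _ "\<lambda>i. (norm (dyadic_block a j i))\<^sup>2"]) auto
    qed
  qed
  have "(\<Sum>l<n. a l) = (\<Sum>j<k. P j - P (Suc j))"
    unfolding sum_lessThan_telescope' using assms by (simp add: P_def)
  then have "(norm (\<Sum>l<n. a l))\<^sup>2 \<le> (\<Sum>j<k. norm (P j - P (Suc j)))\<^sup>2"
    by (auto intro!: power_mono norm_sum)
  also have "\<dots> \<le> (\<Sum>j<k. (norm (P j - P (Suc j)))\<^sup>2) * card {..<k}"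
    by (rule sum_squared_le_sum_of_squares)
  also have "\<dots> \<le> (\<Sum>j<k. \<Sum>i<2 ^ (k - j). (norm (dyadic_block a j i))\<^sup>2) * card {..<k}"
    using piece by (intro mult_right_mono sum_mono) auto
  finally show ?thesis by (simp add: dyadic_energy_def mult.commute)
qed

text \<open>Each \<open>N\<close> between \<open>2 ^ k\<close> and \<open>2 ^ (k + 1)\<close> is
  estimated by the energy at level \<open>k + 1\<close>, where \<open>ln (1 + N)\<close> is
  comparable to \<open>k\<close>.\<close>

lemma log_rate_tendsto_0:
  fixes a :: "nat \<Rightarrow> complex"
  assumes V: "V \<longlonglongrightarrow> 0" "\<And>k. V k \<ge> 0" and "s \<ge> 0"
    and energy: "\<And>k. k \<ge> 1 \<Longrightarrow> dyadic_energy a k = V k * (2 ^ k * real k powr (2 * s))"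
  shows "(\<lambda>N. sqrt (real N) / ln (1 + real N) powr s * norm (1 / of_nat N * (\<Sum>n<N. a n))) \<longlonglongrightarrow> 0"
proof -
  define Q where "Q N = sqrt (real N) / ln (1 + real N) powr s * norm (1 / of_nat N * (\<Sum>n<N. a n))" for N
  \<comment> \<open>The 2 is \<open>2 ^ (k + 1)\<close> over \<open>2 ^ k\<close>, and
    \<open>(k + 1) / (k * ln 2) \<le> 2 / ln 2\<close> for \<open>k \<ge> 1\<close>.\<close>
  define M where "M = 2 * (2 / ln 2) powr (2 * s)"
  have M: "M > 0" by (simp add: M_def)
  have bound: "(Q N)\<^sup>2 \<le> M * V (Suc k)" if k: "2 ^ k \<le> N" "N < 2 ^ (k + 1)" "k \<ge> 1" for N k
  proof -
    have N: "real N \<ge> 2 ^ k" using k(1) by (metis of_nat_le_iff of_nat_numeral of_nat_power)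
    have N0: "real N > 0" using N by (smt (verit) zero_less_power)
    have L: "ln (1 + real N) \<ge> real k * ln 2"
    proof -
      have "real k * ln 2 = ln (2 ^ k)" by (simp add: ln_realpow)
      also have "\<dots> \<le> ln (1 + real N)" 
        by (rule ln_le_cancel_iff[THEN iffD2]) (simp, (use N N0 in linarith)+)
      finally show ?thesis .
    qed
    have kl: "real k * ln 2 > 0" using k(3) by simp
    have "(Q N)\<^sup>2 = (norm (\<Sum>n<N. a n))\<^sup>2 / (real N * ln (1 + real N) powr (2 * s))"
    proof -
      have "(ln (1 + real N) powr s)\<^sup>2 = ln (1 + real N) powr (2 * s)"
        by (simp add: power2_eq_square flip: powr_add)
      then show ?thesis
        using N0 by (simp add: Q_def norm_mult norm_divide power_mult_distrib power_divide power2_eq_square[of "real N"])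
    qed
    also have "\<dots> \<le> dyadic_energy a (Suc k) / (2 ^ k * (real k * ln 2) powr (2 * s))"
    proof (intro frac_le mult_mono partial_sum_le_dyadic_energy dyadic_energy_nonneg)
      show "(real k * ln 2) powr (2 * s) \<le> ln (1 + real N) powr (2 * s)"
        using L kl \<open>s \<ge> 0\<close> by (intro powr_mono2) auto
      have "0 < (real k * ln 2) powr (2 * s)" using kl unfolding powr_gt_zero by linarith
      then show "0 < 2 ^ k * (real k * ln 2) powr (2 * s)" by (intro mult_pos_pos) simp_all
    qed (use k N in auto)
    also have "\<dots> = 2 * V (Suc k) * (real (Suc k) powr (2 * s) / (real k * ln 2) powr (2 * s))"
      by (simp add: energy)
    also have "real (Suc k) powr (2 * s) / (real k * ln 2) powr (2 * s) = (real (Suc k) / (real k * ln 2)) powr (2 * s)"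
      using kl by (simp add: powr_divide)
    also have "2 * V (Suc k) * \<dots> \<le> 2 * V (Suc k) * (2 / ln 2) powr (2 * s)"
    proof (intro mult_left_mono powr_mono2)
      show "real (Suc k) / (real k * ln 2) \<le> 2 / ln 2"
        using k(3) by (simp add: field_simps)
    qed (use V(2) \<open>s \<ge> 0\<close> in auto)
    finally show ?thesis by (simp add: M_def mult_ac)
  qed
  have "Q \<longlonglongrightarrow> 0"
  proof (rule LIMSEQ_I)
    fix r :: real assume r: "r > 0"
    have "eventually (\<lambda>k. V k < r\<^sup>2 / M) sequentially"
      using V(1) r M by (intro order_tendstoD(2)) auto
    then obtain k0 where k0: "\<And>k. k \<ge> k0 \<Longrightarrow> V k < r\<^sup>2 / M"
      unfolding eventually_sequentially by blast
    \<comment> \<open>The extra \<open>Suc\<close> forces \<open>k \<ge> 1\<close>, as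
      \<open>bound\<close> requires.\<close>
    have "norm (Q N - 0) < r" if N: "N \<ge> 2 ^ Suc k0" for N
    proof -
      have "N \<ge> 1" using N by (meson le_trans one_le_numeral one_le_power)
      then obtain k where k: "2 ^ k \<le> N" "N < 2 ^ (k + 1)"
        using ex_power_ivl1[of 2 N] by auto
      have "(2::nat) ^ Suc k0 < 2 ^ (k + 1)" using N k(2) by linarith
      then have "Suc k0 < k + 1" by (rule power_less_imp_less_exp[rotated]) simp
      then have kk: "k \<ge> 1" "Suc k \<ge> k0" by simp_all
      have "(Q N)\<^sup>2 \<le> M * V (Suc k)" by (rule bound[OF k kk(1)])
      also have "\<dots> < r\<^sup>2" using k0[OF kk(2)] M by (simp add: field_simps)
      finally show ?thesis using r power2_less_imp_less[of "\<bar>Q N\<bar>" r] by simp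
    qed
    then show "\<exists>no. \<forall>N\<ge>no. norm (Q N - 0) < r" by blast
  qed
  then show ?thesis by (simp add: Q_def[abs_def])
qed

text \<open>Beppo Levi: the normalised energies \<open>V k\<close> have summable integrals, hence
  tend to 0 almost everywhere, and they control all \<open>N\<close> at once.\<close>

lemma birkhoff_rate:
  assumes det: "det A \<noteq> 0" and [measurable]: "g \<in> borel_measurable borel" and "\<eta> > 0"
    and K: "\<And>N. l2_sq (\<lambda>x. \<Sum>n<N. g ((torus_map A ^^ n) x)) \<le> ennreal (K * real N)"
  shows "AE x in torus. (\<lambda>N. sqrt (real N) / ln (1 + real N) powr (3/2 + \<eta>) *
      norm (1 / of_nat N * (\<Sum>n<N. g ((torus_map A ^^ n) x)))) \<longlonglongrightarrow> 0"
proof -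
  define a where "a x n = g ((torus_map A ^^ n) x)" for x n
  have [measurable]: "(\<lambda>x. a x n) \<in> borel_measurable borel" for n
    unfolding a_def by measurable
  define s where "s = 3/2 + \<eta>"
  define V where "V k x = dyadic_energy (a x) k / (2 ^ k * real k powr (2 * s))" for k x
  have V0: "V k x \<ge> 0" for k x by (simp add: V_def dyadic_energy_nonneg)
  have Vm[measurable]: "(\<lambda>x. V k x) \<in> borel_measurable borel" for k
    unfolding V_def dyadic_energy_def dyadic_block_def by measurable
  have block: "l2_sq (\<lambda>x. dyadic_block (a x) j i) \<le> ennreal (\<bar>K\<bar> * 2 ^ j)" for i j
  proof -
    \<comment> \<open>A block is an initial block started later on the orbit, so invariance of the
      measure reduces it to \<open>K\<close>.\<close>
    have "dyadic_block (a x) j i = (\<Sum>l<2 ^ j. a ((torus_map A ^^ (i * 2 ^ j)) x) l)" for x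
      by (simp add: dyadic_block_def a_def add.commute[of "i * 2 ^ j"] funpow_add)
    then have "l2_sq (\<lambda>x. dyadic_block (a x) j i) = l2_sq (\<lambda>x. \<Sum>l<2 ^ j. a x l)"
      using l2_sq_torus_map_iterate[OF det, of "\<lambda>x. \<Sum>l<2 ^ j. a x l"] by simp
    also have "\<dots> \<le> ennreal (K * real (2 ^ j))" unfolding a_def by (rule K)
    also have "\<dots> \<le> ennreal (\<bar>K\<bar> * 2 ^ j)" by (intro ennreal_leI) simp
    finally show ?thesis .
  qed
  have energy: "(\<integral>\<^sup>+x. ennreal (dyadic_energy (a x) k) \<partial>torus) \<le> ennreal (\<bar>K\<bar> * (real k)\<^sup>2 * 2 ^ k)" for k
  proof -
    have "(\<integral>\<^sup>+x. ennreal (dyadic_energy (a x) k) \<partial>torus)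
        = ennreal (real k) * (\<Sum>j<k. \<Sum>i<2 ^ (k - j). l2_sq (\<lambda>x. dyadic_block (a x) j i))"
      unfolding dyadic_energy_def l2_sq_def dyadic_block_def
      by (simp add: ennreal_mult sum_nonneg nn_integral_cmult nn_integral_sum del: sum_ennreal flip: sum_ennreal)
    also have "\<dots> \<le> ennreal (real k) * (\<Sum>j<k. \<Sum>i<(2::nat) ^ (k - j). ennreal (\<bar>K\<bar> * 2 ^ j))"
      by (intro mult_left_mono sum_mono block) simp
    also have "(\<Sum>j<k. \<Sum>i<(2::nat) ^ (k - j). ennreal (\<bar>K\<bar> * 2 ^ j))
        = ennreal (\<Sum>j<k. \<Sum>i<(2::nat) ^ (k - j). \<bar>K\<bar> * 2 ^ j)"
      by (simp only: sum_ennreal sum_nonneg abs_ge_zero mult_nonneg_nonneg zero_le_power zero_le_numeral)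
    also have "ennreal (real k) * \<dots> = ennreal (real k * (\<Sum>j<k. \<Sum>i<(2::nat) ^ (k - j). \<bar>K\<bar> * 2 ^ j))"
      by (rule ennreal_mult[symmetric]) (simp_all add: sum_nonneg)
    \<comment> \<open>Longer blocks are fewer in the same proportion, so all scales contribute
      equally.\<close>
    also have "(\<Sum>j<k. \<Sum>i<(2::nat) ^ (k - j). \<bar>K\<bar> * 2 ^ j) = (\<Sum>j<k. \<bar>K\<bar> * 2 ^ k)"
    proof (rule sum.cong)
      fix j assume "j \<in> {..<k}"
      then have "(2::real) ^ k = 2 ^ (k - j) * 2 ^ j" by (simp flip: power_add)
      then show "(\<Sum>i<(2::nat) ^ (k - j). \<bar>K\<bar> * 2 ^ j) = \<bar>K\<bar> * 2 ^ k" by simp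
    qed simp
    also have "real k * \<dots> = \<bar>K\<bar> * (real k)\<^sup>2 * 2 ^ k" by (simp add: power2_eq_square)
    finally show ?thesis .
  qed
  have V_int: "(\<integral>\<^sup>+x. ennreal (V k x) \<partial>torus) \<le> ennreal (\<bar>K\<bar> * real k powr (- 1 - 2 * \<eta>))" for k
  proof (cases "k = 0")
    case False
    then have k: "real k > 0" by simp
    define d where "d = 2 ^ k * real k powr (2 * s)"
    have d: "d > 0" using k by (simp add: d_def)
    have "(\<integral>\<^sup>+x. ennreal (V k x) \<partial>torus) = (\<integral>\<^sup>+x. ennreal (1 / d) * ennreal (dyadic_energy (a x) k) \<partial>torus)"
      using d by (intro nn_integral_cong) (simp add: V_def dyadic_energy_nonneg flip: d_def ennreal_mult)
    also have "\<dots> = ennreal (1 / d) * (\<integral>\<^sup>+x. ennreal (dyadic_energy (a x) k) \<partial>torus)"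
      unfolding dyadic_energy_def dyadic_block_def by (rule nn_integral_cmult) measurable
    also have "\<dots> \<le> ennreal (1 / d) * ennreal (\<bar>K\<bar> * (real k)\<^sup>2 * 2 ^ k)"
      by (intro mult_left_mono energy) simp
    also have "\<dots> = ennreal (1 / d * (\<bar>K\<bar> * (real k)\<^sup>2 * 2 ^ k))"
      using d by (intro ennreal_mult[symmetric]) auto
    also have "1 / d * (\<bar>K\<bar> * (real k)\<^sup>2 * 2 ^ k) = \<bar>K\<bar> * (real k powr 2 / real k powr (2 * s))"
      using k by (simp add: d_def)
    also have "real k powr 2 / real k powr (2 * s) = real k powr (- 1 - 2 * \<eta>)"
      unfolding powr_diff[symmetric] by (simp add: s_def algebra_simps)
    finally show ?thesis .
  qed (simp add: V_def dyadic_energy_def)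
  have "(\<integral>\<^sup>+x. (\<Sum>k. ennreal (V k x)) \<partial>torus) = (\<Sum>k. \<integral>\<^sup>+x. ennreal (V k x) \<partial>torus)"
    by (intro nn_integral_suminf) measurable
  also have "\<dots> \<le> (\<Sum>k. ennreal (\<bar>K\<bar> * real k powr (- 1 - 2 * \<eta>)))"
    by (intro suminf_le V_int) auto
  also have "\<dots> = ennreal (\<Sum>k. \<bar>K\<bar> * real k powr (- 1 - 2 * \<eta>))"
    using \<open>\<eta> > 0\<close> by (intro suminf_ennreal2 summable_mult) (auto simp: summable_real_powr_iff)
  finally have "(\<integral>\<^sup>+x. (\<Sum>k. ennreal (V k x)) \<partial>torus) \<noteq> \<infinity>"
    by (auto simp: top_unique)
  then have "AE x in torus. (\<Sum>k. ennreal (V k x)) \<noteq> \<infinity>"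
    by (intro nn_integral_PInf_AE) measurable
  then show ?thesis
  proof eventually_elim
    case (elim x)
    then have "summable (\<lambda>k. V k x)"
      by (intro summable_suminf_not_top V0) simp
    then have lim: "(\<lambda>k. V k x) \<longlonglongrightarrow> 0" by (rule summable_LIMSEQ_zero)
    show ?case
      unfolding s_def[symmetric]
    proof (rule log_rate_tendsto_0[OF lim V0, of s "a x", unfolded a_def])
      show "s \<ge> 0" using \<open>\<eta> > 0\<close> by (simp add: s_def)
      show "dyadic_energy (\<lambda>n. g ((torus_map A ^^ n) x)) k = V k x * (2 ^ k * real k powr (2 * s))" if "k \<ge> 1" for k
        using that by (simp add: V_def a_def[abs_def])
    qed
  qed
qed

text \<open>\<open>f\<close> is only Lebesgue measurable, while composition with iterates is carried
  out for Borel functions. After extension by 0, real and imaginary parts are corrected on a null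
  set.\<close>

lemma Borel_representative_torus:
  assumes "f \<in> borel_measurable torus"
  obtains g N where "(g :: real^2 \<Rightarrow> complex) \<in> borel_measurable borel" "N \<in> null_sets lborel"
    "\<And>x. x \<in> space torus \<Longrightarrow> x \<notin> N \<Longrightarrow> f x = g x"
proof -
  let ?Q = "{x :: real^2. \<forall>i. 0 \<le> x $ i \<and> x $ i < 1}"
  define f' where "f' x = indicator ?Q x *\<^sub>R f x" for x
  have f'[measurable]: "f' \<in> borel_measurable lebesgue"
    using assms unit_square_lebesgue unfolding torus_def f'_def[abs_def]
    by (subst (asm) borel_measurable_restrict_space_iff) simp_all
  have re: "(\<lambda>x. Re (f' x)) \<in> borel_measurable lebesgue" and im: "(\<lambda>x. Im (f' x)) \<in> borel_measurable lebesgue"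
    by measurable
  obtain u where u: "u \<in> borel_measurable lborel" "AE x in lborel. Re (f' x) = u x"
    using completion_ex_borel_measurable_real[OF re] by (elim bexE)
  obtain v where v: "v \<in> borel_measurable lborel" "AE x in lborel. Im (f' x) = v x"
    using completion_ex_borel_measurable_real[OF im] by (elim bexE)
  have "AE x in lborel. f' x = Complex (u x) (v x)"
    using u(2) v(2) by eventually_elim (simp add: complex_eq_iff)
  then obtain N where N: "N \<in> null_sets lborel" "{x \<in> space lborel. f' x \<noteq> Complex (u x) (v x)} \<subseteq> N"
    unfolding eventually_ae_filter by auto
  show ?thesis
  proof (rule that[OF _ N(1)])
    have "(\<lambda>x. of_real (u x) + \<i> * of_real (v x)) \<in> borel_measurable borel"
      using u(1) v(1) by simp
    then show "(\<lambda>x. Complex (u x) (v x)) \<in> borel_measurable borel"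
      by (simp add: Complex_eq)
    show "f x = Complex (u x) (v x)" if "x \<in> space torus" "x \<notin> N" for x
    proof -
      have "f' x = Complex (u x) (v x)" using N(2) that(2) by auto
      then show ?thesis using that(1) by (simp add: f'_def space_torus)
    qed
  qed
qed

text \<open>Iterates preserve the measure, so null sets pull back to null sets, and countably many
  times can be united. Thus \<open>f\<close> and its Borel representative agree along whole
  orbits.\<close>

lemma AE_torus_iterate_avoids_null_set:
  assumes det: "det A \<noteq> 0" and N: "N \<in> null_sets lborel"
  shows "AE x in torus. \<forall>n. (torus_map A ^^ n) x \<notin> N"
proof -
  have [measurable]: "N \<in> sets borel" using N by auto
  have "AE x in lebesgue. x \<notin> N"
    using AE_not_in[OF N] by (rule AE_completion)
  then have "AE x in torus. x \<notin> N"
    unfolding torus_def using unit_square_lebesgue by (subst AE_restrict_space_iff) auto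
  then have "AE x in distr torus borel (\<lambda>x. x). x \<notin> N"
    by (subst AE_distr_iff) simp_all
  then have "AE x in distr torus borel (torus_map A ^^ n). x \<notin> N" for n
    by (simp only: distr_torus_map_iterate[OF det])
  then have "AE x in torus. (torus_map A ^^ n) x \<notin> N" for n
    by (subst (asm) AE_distr_iff) simp_all
  then show ?thesis by (simp add: AE_all_countable)
qed

theorem theorem1p6:
  fixes A :: "int^2^2" and f :: "real^2 \<Rightarrow> complex" and \<delta> :: real
  assumes "det A \<noteq> 0"
    and "\<forall>\<mu>. complex_eigenvalue A \<mu> \<longrightarrow> \<not> root_of_unity \<mu>"
    and "square_integrable torus f"
    and "\<delta> > 0"
    and "(\<lambda>\<xi>. ln (1 + norm (real_vec \<xi>)) powr (1 + \<delta>) * (norm (fourier_coeff f \<xi>))\<^sup>2)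
           summable_on UNIV"
  shows "\<forall>\<eta>>0. AE x in torus.
    (\<lambda>N::nat. sqrt (real N) / ln (1 + real N) powr (3/2 + \<eta>) *
        norm (1 / of_nat N * (\<Sum>n<N. f ((torus_map A ^^ n) x)) - (LINT y|torus. f y)))
      \<longlonglongrightarrow> 0"
proof (intro allI impI)
  fix \<eta> :: real assume \<eta>: "\<eta> > 0"
  note det = assms(1)
  have fm[measurable]: "f \<in> borel_measurable torus" and f2: "integrable torus (\<lambda>x. (norm (f x))\<^sup>2)"
    using assms(3) by (simp_all add: square_integrable_def)
  obtain g0 N where [measurable]: "g0 \<in> borel_measurable borel" and N: "N \<in> null_sets lborel"
    and fg: "\<And>x. x \<in> space torus \<Longrightarrow> x \<notin> N \<Longrightarrow> f x = g0 x"
    by (rule Borel_representative_torus[OF fm]) blast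
  have orbit: "AE x in torus. \<forall>n. f ((torus_map A ^^ n) x) = g0 ((torus_map A ^^ n) x)"
    using AE_torus_iterate_avoids_null_set[OF det N] AE_space
    by eventually_elim (auto intro!: fg torus_map_iterate_in_torus)
  then have ae: "AE x in torus. f x = g0 x"
    by eventually_elim (metis funpow_0)
  define m where "m = (LINT y|torus. f y)"
  define g where "g x = g0 x - m" for x
  have gm[measurable]: "g \<in> borel_measurable borel" unfolding g_def by measurable
  have "l2_sq g0 = (\<integral>\<^sup>+x. ennreal ((norm (f x))\<^sup>2) \<partial>torus)"
    unfolding l2_sq_def using ae by (intro nn_integral_cong_AE) auto
  also have "\<dots> < \<infinity>" using f2 by (simp add: integrable_iff_bounded)
  finally have g0_fin: "l2_sq g0 < \<infinity>" .
  have "l2_sq g \<le> 2 * (l2_sq g0 + l2_sq (\<lambda>_. - m))"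
    using l2_sq_add_le[of g0 "\<lambda>_. - m"] by (simp add: g_def[abs_def])
  also have "\<dots> < \<infinity>"
    using g0_fin by (simp add: l2_sq_def[of "\<lambda>_. - m"] emeasure_torus ennreal_mult_less_top)
  finally have g_fin: "l2_sq g < \<infinity>" .
  have g0_int: "integrable torus g0" by (rule L2_integrable(2)[OF _ g0_fin]) simp
  have m_int: "integrable torus (\<lambda>_. m)" by simp
  have coeff: "fourier_coeff g \<xi> = (if \<xi> = 0 then 0 else fourier_coeff f \<xi>)" for \<xi>
  proof -
    have "fourier_coeff g \<xi> = (LINT x|torus. g0 x * cnj (character \<xi> x) - m * cnj (character \<xi> x))"
      by (simp add: fourier_coeff_character g_def algebra_simps)
    also have "\<dots> = (LINT x|torus. g0 x * cnj (character \<xi> x)) - (LINT x|torus. m * cnj (character \<xi> x))"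
      by (intro Bochner_Integration.integral_diff integrable_mult_character g0_int m_int) simp_all
    also have "(LINT x|torus. g0 x * cnj (character \<xi> x)) = fourier_coeff f \<xi>"
      unfolding fourier_coeff_character using ae by (intro integral_cong_AE) auto
    also have "(LINT x|torus. m * cnj (character \<xi> x)) = m * (if \<xi> = 0 then 1 else 0)"
      using integral_character[of "- \<xi>"] by (simp add: cnj_character)
    finally have "fourier_coeff g \<xi> = fourier_coeff f \<xi> - m * (if \<xi> = 0 then 1 else 0)" .
    moreover have "fourier_coeff f 0 = m" by (simp add: fourier_coeff_character m_def)
    ultimately show ?thesis by simp
  qed
  \<comment> \<open>Centring changes only the coefficient at 0, which has weight 0 because
    \<open>0 powr a\<close> is 0; so the summability of \<open>f\<close> carries over to
    \<open>g\<close>.\<close>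
  have weight_0: "log_weight \<delta> 0 = 0" by (simp add: log_weight_def real_vec_def zero_vec_def[symmetric])
  have weq: "log_weight \<delta> \<xi> * (norm (fourier_coeff g \<xi>))\<^sup>2 = log_weight \<delta> \<xi> * (norm (fourier_coeff f \<xi>))\<^sup>2" for \<xi>
    using weight_0 by (simp add: coeff)
  have summ: "(\<lambda>\<xi>. log_weight \<delta> \<xi> * (norm (fourier_coeff g \<xi>))\<^sup>2) summable_on UNIV"
    using assms(5) by (simp only: weq log_weight_def[symmetric])
  have nr: "char_poly_2 A z \<noteq> 0" if "root_of_unity z" for z
    using assms(2) that char_poly_2_root_imp_eigenvalue by blast
  obtain K where K: "\<And>N. l2_sq (\<lambda>x. \<Sum>n<N. g ((torus_map A ^^ n) x)) \<le> ennreal (K * real N)"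
    using l2_sq_birkhoff_sum_le[OF det nr \<open>\<delta> > 0\<close> gm g_fin _ summ] coeff by auto
  show "AE x in torus. (\<lambda>N. sqrt (real N) / ln (1 + real N) powr (3/2 + \<eta>) *
        norm (1 / of_nat N * (\<Sum>n<N. f ((torus_map A ^^ n) x)) - (LINT y|torus. f y))) \<longlonglongrightarrow> 0"
    using birkhoff_rate[OF det gm \<eta> K] orbit
  proof eventually_elim
    case (elim x)
    \<comment> \<open>At \<open>N = 0\<close> the average is not centred, but the factor
      \<open>sqrt 0\<close> makes both sides vanish.\<close>
    have "1 / of_nat N * (\<Sum>n<N. f ((torus_map A ^^ n) x)) - m = 1 / of_nat N * (\<Sum>n<N. g ((torus_map A ^^ n) x))"
      if "N > 0" for N
      using that elim(2) by (simp add: g_def sum_subtractf field_simps)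
    then have eq: "sqrt (real N) / ln (1 + real N) powr (3/2 + \<eta>) *
        norm (1 / of_nat N * (\<Sum>n<N. f ((torus_map A ^^ n) x)) - m)
      = sqrt (real N) / ln (1 + real N) powr (3/2 + \<eta>) *
        norm (1 / of_nat N * (\<Sum>n<N. g ((torus_map A ^^ n) x)))" for N
      by (cases "N = 0") simp_all
    show ?case using elim(1) by (simp only: eq flip: m_def)
  qed
qed

end
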